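(* Let $X$ be a log-concave real random variable. Then $$h(X) \ \geq\ \tfrac12 \log \operatorname{Var}(X) + 1,$$ with equality for the standard one-sided exponential random variable, i.e. the one with density $e^{-x}\mathbf{1}_{[0,\infty)}(x)$.
   Context: A real random variable $X$ is log-concave if it has a density (with respect to Lebesgue measure) of the form $f=e^{-V}$, where $V:\mathbb{R}\to(-\infty,\infty]$ is convex. For a real random variable $X$ with density $f$, the (Shannon) differential entropy is $h(X)=h(f)=-\int f\log f$, with $\log$ the natural logarithm and $0\log 0=0$. $\operatorname{Var}$ denotes variance. *)

theory Defs
  imports "HOL-Probability.Probability"
begin

text \<open>Extended-real convexity. The exclusion of $-\infty$ keeps the right-hand side from ever
  being $\infty - \infty$; at the end points \<open>0 * \<infinity> = 0\<close> makes the inequality trivial.\<close>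

definition ereal_convex :: "(real \<Rightarrow> ereal) \<Rightarrow> bool" where
  "ereal_convex V \<longleftrightarrow>
     (\<forall>x. V x \<noteq> -\<infinity>) \<and>
     (\<forall>x y t. 0 \<le> t \<and> t \<le> 1 \<longrightarrow>
        V ((1 - t) * x + t * y) \<le> ereal (1 - t) * V x + ereal t * V y)"

text \<open>$e^{-v}$ for $v \in (-\infty, \infty]$; the value at $-\infty$ is irrelevant.\<close>

definition exp_minus :: "ereal \<Rightarrow> real" where
  "exp_minus v = (if v = \<infinity> then 0 else exp (- real_of_ereal v))"

definition log_concave_rv :: "'a measure \<Rightarrow> ('a \<Rightarrow> real) \<Rightarrow> bool" where
  "log_concave_rv M X \<longleftrightarrow>
     (\<exists>V. ereal_convex V \<and> distributed M lborel X (\<lambda>x. ennreal (exp_minus (V x))))"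

text \<open>The library's entropy with respect to Lebesgue measure, in base $e$. The lemma below
  recovers $-\int f \log f$ from it, whichever density $f$ of $X$ is used
  (in Isabelle \<open>ln 0 = 0\<close>, so \<open>0 * ln 0 = 0\<close>). For a log-concave $X$ the function $f \log f$
  is integrable and $X$ has finite second moment, so neither the entropy nor the variance
  takes the default value 0 of a divergent integral.\<close>

definition diff_entropy :: "'a measure \<Rightarrow> ('a \<Rightarrow> real) \<Rightarrow> real" where
  "diff_entropy M X = prob_space.entropy M (exp 1) lborel X"

lemma diff_entropy_density:
  fixes f :: "real \<Rightarrow> real"
  assumes "prob_space M" and "distributed M lborel X (\<lambda>x. ennreal (f x))" and "\<And>x. 0 \<le> f x"
  shows "diff_entropy M X = - (\<integral>x. f x * ln (f x) \<partial>lborel)"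
proof -
  interpret information_space M "exp 1"
    using assms(1) by (simp add: information_space_def information_space_axioms_def)
  show ?thesis
    using entropy_distr[OF assms(2)] assms(3)
    by (simp add: diff_entropy_def log_def)
qed

end

theory Submission
  imports Defs "HOL-Real_Asymp.Real_Asymp"
begin

text \<open>Let $f$ be the density, $H$ its supremum and $c$ a point at which the supremum is approached.
The variable is split at $c$. Let $p$ and $q$ be the masses to the right and to the left of
$c$, let $m_1, m_2$ be the conditional means of the distance to $c$ on the two sides and $s_1, s_2$
the conditional variances. Define $x$ by $-\int_c^\infty f \log f = p\,(1 - \log H - x)$ and
$y$ by the same formula with $q$ on the left. Then $x, y \in [0,1]$; the value 0 belongs to
exponential decay away from $c$ and the value 1 to a constant density. With these parameters
  $$h = 1 - \log H - (p x + q y), \qquad \mathrm{Var} = p s_1 + q s_2 + p q (m_1 + m_2)^2.$$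
On each side log-concavity gives two bounds (\<open>half_line_bounds\<close>):
  $$H^2 s_1 \le p^2 e^{-2x}, \qquad H m_1 \le p\, e^{-x/2}.$$
The theorem thus reduces to
  $$p^3 e^{-2x} + q^3 e^{-2y} + p q\,(p e^{-x/2} + q e^{-y/2})^2 \le e^{-2(px+qy)}$$
for $p + q = 1$ and $x, y \in [0,1]$ (\<open>two_sided_bound\<close>). After division by the right-hand side,
the left-hand side is a positive combination of exponentials of affine functions of $(x,y)$. It is
therefore convex in each variable, and the four corners of the unit square decide.

The half-line bounds concern the iterated tails
  $$S = \int_x^\infty f, \qquad S_1 = \int_x^\infty S, \qquad S_2 = \int_x^\infty S_1.$$
They are derived by one pattern: a function whose
derivative is nonpositive and whose limit at the right end of the support is nonnegative is itself
nonnegative (\<open>nonneg_from_end\<close>).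
The variance bound (\<open>entropy_ge_variance\<close>) rests on monotonicity of the hazard rate $f/S$, which
gives $f S_1 \le S^2$, and on monotonicity of $f$, which gives $S^2 \le 2 f S_1$ and
$2 S_1^2 \le 3 S S_2$. The mean bound (\<open>entropy_ge_mean\<close>) compares the normalised reciprocal hazard
rate, as a function of the tail mass $s$, with $\min(1, s/\kappa)$ for a suitable $\kappa$.

For the exponential density one has $p = 1$ and $x = 0$, and the two half-line bounds and the
last inequality are equalities.\<close>

section \<open>Tail integrals\<close>

definition tail :: "(real \<Rightarrow> real) \<Rightarrow> real \<Rightarrow> real" where
  "tail g x = (LINT y:{x..}|lborel. g y)"

lemma integrable_imp_set_integrable:
  fixes g :: "real \<Rightarrow> real"
  assumes "integrable lborel g" "A \<in> sets lborel"
  shows "set_integrable lborel A g"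
  unfolding set_integrable_def using assms(2,1) by (rule integrable_mult_indicator)

text \<open>Cutting off a compact interval turns a tail into a Henstock--Kurzweil integral, for which the
fundamental theorem of calculus is available.\<close>

lemma tail_split:
  assumes "integrable lborel g" "x \<le> b"
  shows "tail g x = integral {x..b} g + tail g b"
proof -
  have i: "set_integrable lborel A g" if "A \<in> sets lborel" for A
    using integrable_imp_set_integrable[OF assms(1) that] .
  have u: "{x..} = {x..<b} \<union> {b..}" using assms(2) by auto
  have "tail g x = (LINT y:{x..<b}|lborel. g y) + tail g b"
    unfolding tail_def u by (rule set_integral_Un) (auto intro: i)
  also have "(LINT y:{x..<b}|lborel. g y) = (LINT y:{x..b}|lborel. g y)"
    by (rule set_integral_cong_set)
       (use assms(1) AE_lborel_singleton[of b] in \<open>auto simp: set_borel_measurable_def elim!: eventually_mono\<close>)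
  also have "\<dots> = integral {x..b} g"
    using i[of "{x..b}"] by (intro set_borel_integral_eq_integral) auto
  finally show ?thesis .
qed

lemma tail_has_derivative:
  assumes g: "integrable lborel g" and U: "open U" "x \<in> U" "continuous_on U g"
  shows "(tail g has_real_derivative - g x) (at x)"
proof -
  obtain e where e: "e > 0" "cball x e \<subseteq> U"
    using U by (meson open_contains_cball)
  have s: "{x - e..x + e} \<subseteq> U" using e by (auto simp: cball_eq_atLeastAtMost)
  then have c: "continuous_on {x - e..x + e} g" using U(3) continuous_on_subset by blast
  have "((\<lambda>t. integral {x-e..t} g) has_real_derivative g x) (at x within {x-e..x+e})"
    by (rule integral_has_real_derivative[OF c]) (use e in auto)
  then have d: "((\<lambda>t. integral {x-e..t} g) has_real_derivative g x) (at x)"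
    using e at_within_Icc_at[of "x - e" x "x + e"] by simp
  have d': "((\<lambda>t. tail g (x - e) - integral {x-e..t} g) has_real_derivative - g x) (at x)"
    using d by (auto intro!: derivative_eq_intros)
  have "\<forall>\<^sub>F t in nhds x. t \<in> {x - e<..}" using e by (intro eventually_nhds_in_open) auto
  then have ev: "\<forall>\<^sub>F t in nhds x. tail g (x - e) - integral {x-e..t} g = tail g t"
    by (rule eventually_mono) (simp add: tail_split[OF g less_imp_le])
  show ?thesis
    using iffD1[OF DERIV_cong_ev[OF refl ev refl] d'] .
qed

text \<open>Continuity at points where \<open>g\<close> itself may jump; it carries inequalities from the interior of
the support to the mode.\<close>

lemma tail_continuous:
  assumes g: "integrable lborel g"
  shows "isCont (tail g) x"
  unfolding continuous_at_sequentially o_def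
proof (intro allI impI)
  fix u :: "nat \<Rightarrow> real" assume u: "u \<longlonglongrightarrow> x"
  show "(\<lambda>n. tail g (u n)) \<longlonglongrightarrow> tail g x"
    unfolding tail_def set_lebesgue_integral_def
  proof (rule integral_dominated_convergence[where w="\<lambda>y. norm (g y)"])
    show "AE y in lborel. (\<lambda>n. indicat_real {u n..} y *\<^sub>R g y) \<longlonglongrightarrow> indicat_real {x..} y *\<^sub>R g y"
      using AE_lborel_singleton[of x]
    proof (rule eventually_mono)
      fix y assume "y \<noteq> x"
      then have "\<forall>\<^sub>F n in sequentially. indicat_real {u n..} y *\<^sub>R g y = indicat_real {x..} y *\<^sub>R g y"
      proof (cases "x < y")
        case True
        show ?thesis
          by (rule eventually_mono[OF order_tendstoD(2)[OF u True]]) (use True in \<open>auto simp: indicator_def\<close>)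
      next
        case False
        then have "y < x" using \<open>y \<noteq> x\<close> by auto
        show ?thesis
          by (rule eventually_mono[OF order_tendstoD(1)[OF u \<open>y < x\<close>]]) (use \<open>y < x\<close> in \<open>auto simp: indicator_def\<close>)
      qed
      then show "(\<lambda>n. indicat_real {u n..} y *\<^sub>R g y) \<longlonglongrightarrow> indicat_real {x..} y *\<^sub>R g y"
        by (rule tendsto_eventually)
    qed
  qed (use g in \<open>auto simp: indicator_def\<close>)
qed

text \<open>The sequence \<open>u\<close> need only pass every point of the support of \<open>g\<close>, so that bounded and
unbounded supports are treated alike.\<close>

lemma tail_tendsto_0:
  assumes g: "integrable lborel g" 
    and u: "\<And>y. g y \<noteq> 0 \<Longrightarrow> \<forall>\<^sub>F n in sequentially. y < u n"
  shows "(\<lambda>n. tail g (u n)) \<longlonglongrightarrow> 0"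
proof -
  have "(\<lambda>n. tail g (u n)) \<longlonglongrightarrow> (\<integral>y. 0 \<partial>(lborel::real measure))"
    unfolding tail_def set_lebesgue_integral_def
  proof (rule integral_dominated_convergence[where w="\<lambda>y. norm (g y)"])
    show "AE y in lborel. (\<lambda>n. indicat_real {u n..} y *\<^sub>R g y) \<longlonglongrightarrow> 0"
    proof (rule AE_I2)
      fix y :: real
      have "\<forall>\<^sub>F n in sequentially. indicat_real {u n..} y *\<^sub>R g y = 0"
        by (cases "g y = 0") (use u[of y] in \<open>auto elim!: eventually_mono\<close>)
      then show "(\<lambda>n. indicat_real {u n..} y *\<^sub>R g y) \<longlonglongrightarrow> 0"
        by (rule tendsto_eventually)
    qed
  qed (use g in \<open>auto simp: indicator_def\<close>)
  then show ?thesis by simp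
qed

lemma tail_nonneg: 
  assumes "\<And>y. y \<ge> x \<Longrightarrow> 0 \<le> g y"
  shows "0 \<le> tail g x"
  unfolding tail_def set_lebesgue_integral_def using assms
  by (intro Bochner_Integration.integral_nonneg) (auto simp: indicator_def)

lemma tail_mono:
  assumes "integrable lborel g" "integrable lborel h" "\<And>y. y \<ge> x \<Longrightarrow> g y \<le> h y"
  shows "tail g x \<le> tail h x"
  unfolding tail_def using assms 
  by (intro set_integral_mono integrable_imp_set_integrable) auto

lemma tail_pos:
  assumes g: "integrable lborel g" and nn: "\<And>y. y \<ge> x \<Longrightarrow> 0 \<le> g y"
    and z: "x \<le> z" "isCont g z" "0 < g z"
  shows "0 < tail g x"
proof -
  have "\<forall>\<^sub>F y in nhds z. g y > g z / 2"
    using z(2,3) by (intro order_tendstoD(1)[where y="g z"]) (auto simp: isCont_def tendsto_at_iff_tendsto_nhds)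
  then obtain e where e: "e > 0" "\<And>y. dist y z < e \<Longrightarrow> g z / 2 < g y"
    by (auto simp: eventually_nhds_metric)
  define b where "b = z + e / 2"
  have b: "z < b" using e by (auto simp: b_def)
  have gz: "g z / 2 \<le> g y" if "y \<in> {z..b}" for y
    using e(2)[of y] that e(1) by (auto simp: b_def dist_real_def)
  have "tail g x = integral {x..z} g + tail g z" using tail_split[OF g z(1)] .
  also have "tail g z = integral {z..b} g + tail g b" using tail_split[OF g, of z b] b by simp
  finally have eq: "tail g x = integral {x..z} g + (integral {z..b} g + tail g b)" .
  have io: "g integrable_on {u..v}" for u v
    by (rule set_borel_integral_eq_integral(1)[OF integrable_imp_set_integrable[OF g]]) simp
  have "integral {z..b} (\<lambda>_. g z / 2) \<le> integral {z..b} g"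
    by (rule integral_le) (use io gz in auto)
  then have "g z / 2 * (b - z) \<le> integral {z..b} g" using b by (simp add: mult.commute)
  moreover have "0 < g z / 2 * (b - z)" using b z by simp
  moreover have "0 \<le> integral {x..z} g" by (rule integral_nonneg) (use io nn in auto)
  moreover have "0 \<le> tail g b" using nn z b by (intro tail_nonneg) auto
  ultimately show ?thesis unfolding eq by linarith
qed

lemma tail_cong: "(\<And>y. x \<le> y \<Longrightarrow> g y = h y) \<Longrightarrow> tail g x = tail h x"
  unfolding tail_def by (rule set_lebesgue_integral_cong) auto

lemma tail_lincomb:
  assumes "integrable lborel g" "integrable lborel h"
  shows "tail (\<lambda>y. a * g y + b * h y) x = a * tail g x + b * tail h x"
  using assms unfolding tail_def
  by (simp add: integrable_imp_set_integrable set_integral_add)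

section \<open>A log-concave density beyond its mode\<close>

text \<open>The situation to the right of a mode \<open>c\<close>. When the density is largest at an end point of its
support, \<open>H\<close> is only a one-sided limit at \<open>c\<close>. For this reason the comparison of hazard rates with the one at \<open>c\<close>, which should be \<open>H / tail f c\<close>, is a separate
assumption.\<close>

locale log_concave_half_line =
  fixes f :: "real \<Rightarrow> real" and c H :: real
  assumes f_nonneg: "0 \<le> f x"
    and f_integrable: "integrable lborel f"
    and moment1_integrable: "integrable lborel (\<lambda>y. y * f y)"
    and moment2_integrable: "integrable lborel (\<lambda>y. y\<^sup>2 * f y)"
    and entropy_integrable: "integrable lborel (\<lambda>y. f y * ln (f y))"
    and open_support: "open {x. 0 < f x}"
    and f_continuous: "continuous_on {x. 0 < f x} f"
    and f_le: "f x \<le> H"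
    and f_antimono: "c < x \<Longrightarrow> x \<le> y \<Longrightarrow> f y \<le> f x"
    and hazard_mono: "c < x \<Longrightarrow> x \<le> y \<Longrightarrow> f x * tail f y \<le> f y * tail f x"
    and hazard_ge: "c < x \<Longrightarrow> H * tail f x \<le> f x * tail f c"
begin

text \<open>The iterated tails and the entropy collected beyond \<open>x\<close>. Writing \<open>S1\<close> and \<open>S2\<close> through moments
instead of iterated integrals avoids Fubini's theorem: their derivatives \<open>- S\<close> and \<open>- S1\<close>
come from the product rule.\<close>

definition S :: "real \<Rightarrow> real" where "S = tail f"
definition S1 :: "real \<Rightarrow> real" where "S1 x = tail (\<lambda>y. y * f y) x - x * S x"
definition S2 :: "real \<Rightarrow> real" where
  "S2 x = (tail (\<lambda>y. y\<^sup>2 * f y) x - 2 * x * tail (\<lambda>y. y * f y) x + x\<^sup>2 * S x) / 2"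
definition N :: "real \<Rightarrow> real" where "N x = - tail (\<lambda>y. f y * ln (f y)) x"
definition D :: "real set" where "D = {x. c < x \<and> 0 < f x}"

lemma S1_tail: "S1 x = tail (\<lambda>y. (y - x) * f y) x"
  unfolding S1_def S_def
  using tail_lincomb[OF moment1_integrable f_integrable, of 1 "- x" x] by (simp add: algebra_simps)

lemma shifted_moment1_integrable: "integrable lborel (\<lambda>y. (y - a) * f y)"
  using Bochner_Integration.integrable_diff[OF moment1_integrable integrable_mult_right[OF f_integrable, of a]]
  by (simp add: algebra_simps)

lemma shifted_moment2_integrable: "integrable lborel (\<lambda>y. (y - a)\<^sup>2 * f y)"
  using Bochner_Integration.integrable_add[OF moment2_integrable
    Bochner_Integration.integrable_add[OF integrable_mult_right[OF moment1_integrable, of "-2*a"] 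
     integrable_mult_right[OF f_integrable, of "a\<^sup>2"]]]
  by (simp add: algebra_simps power2_eq_square)

lemma S2_tail: "2 * S2 x = tail (\<lambda>y. (y - x)\<^sup>2 * f y) x"
proof -
  have "tail (\<lambda>y. (y - x)\<^sup>2 * f y) x = tail (\<lambda>y. 1 * (y\<^sup>2 * f y) + 1 * ((-2*x) * (y * f y) + x\<^sup>2 * f y)) x"
    by (rule tail_cong) (simp add: algebra_simps power2_eq_square)
  also have "\<dots> = tail (\<lambda>y. y\<^sup>2 * f y) x + tail (\<lambda>y. (-2*x) * (y * f y) + x\<^sup>2 * f y) x"
    using tail_lincomb[OF moment2_integrable Bochner_Integration.integrable_add[OF
       integrable_mult_right[OF moment1_integrable, of "-2*x"] integrable_mult_right[OF f_integrable, of "x\<^sup>2"]], of 1 1 x]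
    by simp
  also have "tail (\<lambda>y. (-2*x) * (y * f y) + x\<^sup>2 * f y) x = (-2*x) * tail (\<lambda>y. y * f y) x + x\<^sup>2 * tail f x"
    by (rule tail_lincomb[OF moment1_integrable f_integrable])
  finally show ?thesis by (simp add: S2_def S_def)
qed

lemma D_convex: "x \<in> D \<Longrightarrow> c < y \<Longrightarrow> y \<le> x \<Longrightarrow> y \<in> D"
  using f_antimono[of y x] by (auto simp: D_def)

lemma D_bounds: "x \<in> D \<Longrightarrow> c < x" "x \<in> D \<Longrightarrow> 0 < f x"
  by (auto simp: D_def)

lemma isCont_f: "x \<in> D \<Longrightarrow> isCont f x"
  using f_continuous open_support by (auto simp: D_def continuous_on_eq_continuous_at)

lemma S_pos: assumes "x \<in> D" shows "0 < S x"
  unfolding S_def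
  by (rule tail_pos[OF f_integrable f_nonneg order_refl isCont_f[OF assms]]) (use assms in \<open>simp add: D_def\<close>)

lemma exists_later: assumes "x \<in> D" shows "\<exists>z>x. z \<in> D"
proof -
  obtain e where "e > 0" "ball x e \<subseteq> {x. 0 < f x}"
    using open_support assms by (auto simp: D_def open_contains_ball)
  then show ?thesis using assms
    by (intro exI[of _ "x + e/2"]) (auto simp: D_def dist_real_def subset_iff)
qed

lemma S1_pos: assumes "x \<in> D" shows "0 < S1 x"
proof -
  obtain z where "z > x" "z \<in> D" using exists_later[OF assms] by blast
  then show ?thesis
    unfolding S1_tail using isCont_f[of z]
    by (intro tail_pos[OF shifted_moment1_integrable, of x x z])
       (auto simp: f_nonneg D_def)
qed

lemma S_nonneg: "0 \<le> S x" unfolding S_def by (rule tail_nonneg) (rule f_nonneg)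
lemma S1_nonneg: "0 \<le> S1 x" unfolding S1_tail by (rule tail_nonneg) (simp add: f_nonneg)
lemma S2_nonneg: "0 \<le> S2 x"
  using tail_nonneg[of x "\<lambda>y. (y - x)\<^sup>2 * f y"] S2_tail[of x] by (simp add: f_nonneg)

lemma S_deriv: "x \<in> D \<Longrightarrow> (S has_real_derivative - f x) (at x)"
  unfolding S_def by (rule tail_has_derivative[OF f_integrable open_support _ f_continuous]) (simp add: D_def)

lemma N_deriv: assumes "x \<in> D" shows "(N has_real_derivative f x * ln (f x)) (at x)"
proof -
  have "continuous_on {x. 0 < f x} (\<lambda>y. f y * ln (f y))"
    by (intro continuous_intros f_continuous) auto
  from tail_has_derivative[OF entropy_integrable open_support _ this, of x] 
  have "(tail (\<lambda>y. f y * ln (f y)) has_real_derivative - (f x * ln (f x))) (at x)"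
    using assms by (simp add: D_def)
  from DERIV_minus[OF this] show ?thesis by (simp add: N_def[abs_def])
qed

lemma moment1_deriv: "x \<in> D \<Longrightarrow> (tail (\<lambda>y. y * f y) has_real_derivative - (x * f x)) (at x)"
  by (rule tail_has_derivative[OF moment1_integrable open_support])
     (auto simp: D_def intro!: continuous_intros f_continuous)

lemma moment2_deriv: "x \<in> D \<Longrightarrow> (tail (\<lambda>y. y\<^sup>2 * f y) has_real_derivative - (x\<^sup>2 * f x)) (at x)"
  by (rule tail_has_derivative[OF moment2_integrable open_support])
     (auto simp: D_def intro!: continuous_intros f_continuous)

lemma S1_deriv: "x \<in> D \<Longrightarrow> (S1 has_real_derivative - S x) (at x)"
  unfolding S1_def[abs_def] 
  by (rule derivative_eq_intros moment1_deriv S_deriv refl | assumption)+ (simp add: algebra_simps)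

lemma S2_deriv: "x \<in> D \<Longrightarrow> (S2 has_real_derivative - S1 x) (at x)"
  unfolding S2_def[abs_def]
  by (rule derivative_eq_intros moment1_deriv moment2_deriv S_deriv refl | assumption)+
     (auto simp: S1_def algebra_simps power2_eq_square diff_divide_distrib)

lemmas tail_derivs = S_deriv S1_deriv S2_deriv N_deriv

lemma S_cont: "isCont S x" unfolding S_def by (rule tail_continuous[OF f_integrable])
lemma S1_cont: "isCont S1 x" unfolding S1_def[abs_def]
  by (intro continuous_intros tail_continuous moment1_integrable S_cont)
lemma S2_cont: "isCont S2 x" unfolding S2_def[abs_def]
  by (intro continuous_intros tail_continuous moment1_integrable moment2_integrable S_cont) auto
lemma N_cont: "isCont N x" unfolding N_def[abs_def]
  by (intro continuous_intros tail_continuous entropy_integrable)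

text \<open>A sequence in \<open>D\<close> that runs to its right end, be that end finite or infinite.\<close>

definition exhausts :: "(nat \<Rightarrow> real) \<Rightarrow> bool" where
  "exhausts u \<longleftrightarrow> (\<forall>n. u n \<in> D) \<and> (\<forall>y\<in>D. \<forall>\<^sub>F n in sequentially. y < u n)"

text \<open>\<open>D\<close> is an open interval starting at \<open>c\<close>; the two cases are a finite and an infinite right end.\<close>

lemma exhausts_exists: assumes "D \<noteq> {}" shows "\<exists>u. exhausts u"
proof -
  obtain d where d: "d \<in> D" using assms by blast
  show ?thesis
  proof (cases "bdd_above D")
    case True
    define B where "B = Sup D"
    have le: "y < B" if "y \<in> D" for y
      using exists_later[OF that] cSup_upper[OF _ True] by (force simp: B_def)
    have mem: "y \<in> D" if "c < y" "y < B" for y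
      using that(2) less_cSupD[OF assms, of y] D_convex[of _ y] that(1) by (force simp: B_def)
    define u where "u n = B - (B - d) / (real n + 1)" for n
    have "u n \<in> D" for n
    proof (rule mem)
      have "(B - d) / (real n + 1) \<le> B - d" using le[OF d] by (simp add: field_simps mult_right_mono)
      then show "c < u n" using D_bounds(1)[OF d] by (simp add: u_def)
    qed (use le[OF d] in \<open>simp add: u_def\<close>)
    moreover have "u \<longlonglongrightarrow> B" unfolding u_def by real_asymp
    then have "\<forall>\<^sub>F n in sequentially. y < u n" if "y \<in> D" for y
      using order_tendstoD(1)[OF _ le[OF that]] by blast
    ultimately show ?thesis by (auto simp: exhausts_def)
  next
    case False
    have mem: "y \<in> D" if "c < y" for y
    proof -
      obtain z where "z \<in> D" "y < z" using False by (auto simp: bdd_above_def not_le)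
      then show ?thesis using D_convex[of z y] that by simp
    qed
    have "exhausts (\<lambda>n. c + 1 + real n)"
      unfolding exhausts_def
    proof (intro conjI allI ballI)
      fix y 
      have "filterlim (\<lambda>n. c + 1 + real n) at_top sequentially" by real_asymp
      then show "\<forall>\<^sub>F n in sequentially. y < c + 1 + real n" 
        by (simp add: filterlim_at_top_dense)
    qed (auto intro: mem)
    then show ?thesis by blast
  qed
qed

lemma exhausts_tail:
  assumes u: "exhausts u" and g: "integrable lborel g" and z: "\<And>y. f y = 0 \<Longrightarrow> g y = 0"
  shows "(\<lambda>n. tail g (u n)) \<longlonglongrightarrow> 0"
proof (rule tail_tendsto_0[OF g])
  fix y assume "g y \<noteq> 0"
  then have "0 < f y" using z f_nonneg[of y] by (auto simp: le_less)
  show "\<forall>\<^sub>F n in sequentially. y < u n"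
  proof (cases "c < y")
    case True
    then show ?thesis using u \<open>0 < f y\<close> by (auto simp: exhausts_def D_def)
  next
    case False
    then have "y < u n" for n using u D_bounds(1)[of "u n"] by (auto simp: exhausts_def)
    then show ?thesis by simp
  qed
qed

lemma exhausts_S: "exhausts u \<Longrightarrow> (\<lambda>n. S (u n)) \<longlonglongrightarrow> 0"
  unfolding S_def by (rule exhausts_tail[OF _ f_integrable])

lemma exhausts_N: "exhausts u \<Longrightarrow> (\<lambda>n. N (u n)) \<longlonglongrightarrow> 0"
  unfolding N_def using exhausts_tail[OF _ entropy_integrable, of u] tendsto_minus by fastforce

lemma exhausts_S1: assumes u: "exhausts u" shows "(\<lambda>n. S1 (u n)) \<longlonglongrightarrow> 0"
proof (rule tendsto_sandwich[OF _ _ tendsto_const])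
  show "(\<lambda>n. tail (\<lambda>y. (y - c) * f y) (u n)) \<longlonglongrightarrow> 0"
    by (rule exhausts_tail[OF u shifted_moment1_integrable]) simp
  have "S1 (u n) \<le> tail (\<lambda>y. (y - c) * f y) (u n)" for n
    unfolding S1_tail using u D_bounds(1)[of "u n"]
    by (intro tail_mono shifted_moment1_integrable mult_right_mono f_nonneg) (auto simp: exhausts_def less_imp_le)
  then show "\<forall>\<^sub>F n in sequentially. S1 (u n) \<le> tail (\<lambda>y. (y - c) * f y) (u n)" by simp
qed (simp add: S1_nonneg)

lemma exhausts_S2: assumes u: "exhausts u" shows "(\<lambda>n. S2 (u n)) \<longlonglongrightarrow> 0"
proof (rule tendsto_sandwich[OF _ _ tendsto_const])
  show "(\<lambda>n. tail (\<lambda>y. (y - c)\<^sup>2 * f y) (u n)) \<longlonglongrightarrow> 0"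
    by (rule exhausts_tail[OF u shifted_moment2_integrable]) simp
  have "S2 (u n) \<le> tail (\<lambda>y. (y - c)\<^sup>2 * f y) (u n)" for n
  proof -
    have "2 * S2 (u n) \<le> tail (\<lambda>y. (y - c)\<^sup>2 * f y) (u n)"
      unfolding S2_tail using u D_bounds(1)[of "u n"]
      by (intro tail_mono shifted_moment2_integrable mult_right_mono f_nonneg power_mono) (auto simp: exhausts_def less_imp_le)
    then show ?thesis using S2_nonneg[of "u n"] by linarith
  qed
  then show "\<forall>\<^sub>F n in sequentially. S2 (u n) \<le> tail (\<lambda>y. (y - c)\<^sup>2 * f y) (u n)" by simp
qed (simp add: S2_nonneg)

lemmas exhausts_tendsto = exhausts_S exhausts_S1 exhausts_S2 exhausts_N

text \<open>The principle behind all inequalities on the half-line: \<open>g\<close> decreases to a limit that is at least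
0. Only an asymptotic lower bound \<open>h\<close> for \<open>g\<close> is demanded, since in \<open>entropy_ge_on\<close> some terms of
\<open>g\<close> are bounded below by simpler ones near the end.\<close>

lemma nonneg_from_end:
  assumes x: "x \<in> D"
    and d: "\<And>y. y \<in> D \<Longrightarrow> x \<le> y \<Longrightarrow> (g has_real_derivative g' y) (at y)"
    and np: "\<And>y. y \<in> D \<Longrightarrow> x \<le> y \<Longrightarrow> g' y \<le> 0"
    and lim: "\<And>u. exhausts u \<Longrightarrow> \<exists>h. h \<longlonglongrightarrow> 0 \<and> (\<forall>\<^sub>F n in sequentially. h n \<le> g (u n))"
  shows "0 \<le> g x"
proof -
  obtain u where u: "exhausts u" using exhausts_exists x by blast
  obtain h where h: "h \<longlonglongrightarrow> 0" "\<forall>\<^sub>F n in sequentially. h n \<le> g (u n)" using lim[OF u] by blast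
  have "\<forall>\<^sub>F n in sequentially. x < u n" using u x by (auto simp: exhausts_def)
  with h(2) have "\<forall>\<^sub>F n in sequentially. h n \<le> g x"
  proof eventually_elim
    case (elim n)
    have "g (u n) \<le> g x"
    proof (rule DERIV_nonpos_imp_nonincreasing[of x "u n"])
      fix y assume y: "x \<le> y" "y \<le> u n"
      have "u n \<in> D" using u by (auto simp: exhausts_def)
      then have "y \<in> D" by (rule D_convex) (use y D_bounds(1)[OF x] in auto)
      then show "\<exists>z. (g has_real_derivative z) (at y) \<and> z \<le> 0" using d np y by blast
    qed (use elim in simp)
    then show ?case using elim by simp
  qed
  then show ?thesis by (intro tendsto_upperbound[OF h(1)]) auto
qed

lemma nonneg_at_mode:
  fixes g :: "real \<Rightarrow> real"
  assumes ne: "D \<noteq> {}" and g: "isCont g c" "\<And>x. x \<in> D \<Longrightarrow> 0 \<le> g x"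
  shows "0 \<le> g c"
proof -
  obtain d where d: "d \<in> D" using ne by blast
  have lim: "(g \<longlongrightarrow> g c) (at_right c)" using g(1) by (auto simp: isCont_def filterlim_at_split)
  have "\<forall>\<^sub>F x in at_right c. x \<in> {c<..<d}" 
    using D_bounds(1)[OF d] by (rule eventually_at_right_real)
  then have "\<forall>\<^sub>F x in at_right c. 0 \<le> g x"
    by (rule eventually_mono) (use D_convex[OF d] g(2) in auto)
  then show ?thesis by (intro tendsto_lowerbound[OF lim]) auto
qed

end

section \<open>Entropy against variance on a half-line\<close>

context log_concave_half_line begin

text \<open>Six inequalities between the iterated tails. For an exponential density of rate $k$ one has
$S = f/k$, $S_1 = f/k^2$, $S_2 = f/k^3$, and for a constant density the tails are $t$, $t^2/2$ and
$t^3/6$ times a constant, with $t$ the distance to the right end. A decreasing density lies between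
these two extremes: the first three inequalities are equalities for a constant density,
the others for an exponential one.

In the first two, the value of \<open>f\<close> at the left end is frozen, because \<open>f\<close> is
merely monotone and its derivative cannot be used.\<close>

lemma S_square_le: assumes x: "x \<in> D" "x \<le> y" "y \<in> D" shows "(S y)\<^sup>2 \<le> 2 * f x * S1 y"
proof -
  have "0 \<le> 2 * f x * S1 y - (S y)\<^sup>2"
  proof (rule nonneg_from_end[OF x(3)])
    fix z assume z: "z \<in> D" "y \<le> z"
    show "((\<lambda>y. 2 * f x * S1 y - (S y)\<^sup>2) has_real_derivative 2 * S z * (f z - f x)) (at z)"
      by (rule derivative_eq_intros tail_derivs z refl)+ (simp add: algebra_simps)
    have "f z \<le> f x" using x z D_bounds by (intro f_antimono) auto
    then show "2 * S z * (f z - f x) \<le> 0" using S_nonneg by (intro mult_nonneg_nonpos) auto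
  next
    fix u assume "exhausts u"
    then have "(\<lambda>n. 2 * f x * S1 (u n) - (S (u n))\<^sup>2) \<longlonglongrightarrow> 2 * f x * 0 - 0\<^sup>2"
      by (intro tendsto_intros exhausts_tendsto)
    then show "\<exists>h. h \<longlonglongrightarrow> 0 \<and> (\<forall>\<^sub>F n in sequentially. h n \<le> 2 * f x * S1 (u n) - (S (u n))\<^sup>2)"
      by (intro exI[of _ "\<lambda>n. 2 * f x * S1 (u n) - (S (u n))\<^sup>2"]) auto
  qed
  then show ?thesis by simp
qed

lemma S_S1_le: assumes x: "x \<in> D" shows "S x * S1 x \<le> 3 * f x * S2 x"
proof -
  have "0 \<le> 3 * f x * S2 x - S x * S1 x"
  proof (rule nonneg_from_end[OF x, where g="\<lambda>y. 3 * f x * S2 y - S y * S1 y"])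
    fix z assume z: "z \<in> D" "x \<le> z"
    show "((\<lambda>y. 3 * f x * S2 y - S y * S1 y) has_real_derivative 
       (S z)\<^sup>2 - 2 * f x * S1 z + S1 z * (f z - f x)) (at z)"
      by (rule derivative_eq_intros tail_derivs z refl)+ (simp add: algebra_simps power2_eq_square)
    have "f z \<le> f x" using x z D_bounds by (intro f_antimono) auto
    then have "S1 z * (f z - f x) \<le> 0" using S1_nonneg by (intro mult_nonneg_nonpos) auto
    then show "(S z)\<^sup>2 - 2 * f x * S1 z + S1 z * (f z - f x) \<le> 0" 
      using S_square_le[OF x z(2,1)] by simp
  next
    fix u assume "exhausts u"
    then have "(\<lambda>n. 3 * f x * S2 (u n) - S (u n) * S1 (u n)) \<longlonglongrightarrow> 3 * f x * 0 - 0 * 0"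
      by (intro tendsto_intros exhausts_tendsto)
    then show "\<exists>h. h \<longlonglongrightarrow> 0 \<and> (\<forall>\<^sub>F n in sequentially. h n \<le> 3 * f x * S2 (u n) - S (u n) * S1 (u n))"
      by (intro exI[of _ "\<lambda>n. 3 * f x * S2 (u n) - S (u n) * S1 (u n)"]) auto
  qed
  then show ?thesis by simp
qed

lemma S1_square_le: assumes x: "x \<in> D" shows "2 * (S1 x)\<^sup>2 \<le> 3 * S x * S2 x"
proof -
  have "0 \<le> 3 * S x * S2 x - 2 * (S1 x)\<^sup>2"
  proof (rule nonneg_from_end[OF x])
    fix z assume z: "z \<in> D" "x \<le> z"
    show "((\<lambda>y. 3 * S y * S2 y - 2 * (S1 y)\<^sup>2) has_real_derivative S z * S1 z - 3 * f z * S2 z) (at z)"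
      by (rule derivative_eq_intros tail_derivs z refl)+ (simp add: algebra_simps power2_eq_square)
    show "S z * S1 z - 3 * f z * S2 z \<le> 0" 
      using S_S1_le[OF z(1)] by simp
  next
    fix u assume "exhausts u"
    then have "(\<lambda>n. 3 * S (u n) * S2 (u n) - 2 * (S1 (u n))\<^sup>2) \<longlonglongrightarrow> 3 * 0 * 0 - 2 * 0\<^sup>2"
      by (intro tendsto_intros exhausts_tendsto)
    then show "\<exists>h. h \<longlonglongrightarrow> 0 \<and> (\<forall>\<^sub>F n in sequentially. h n \<le> 3 * S (u n) * S2 (u n) - 2 * (S1 (u n))\<^sup>2)"
      by (intro exI[of _ "\<lambda>n. 3 * S (u n) * S2 (u n) - 2 * (S1 (u n))\<^sup>2"]) auto
  qed
  then show ?thesis by simp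
qed

text \<open>The hazard rate \<open>f / S\<close> increases, so beyond \<open>x\<close> the density dominates \<open>f x / S x\<close> times its own
tail.\<close>

lemma S_square_ge: assumes x: "x \<in> D" shows "f x * S1 x \<le> (S x)\<^sup>2"
proof -
  have "0 \<le> S x * S x - f x * S1 x"
  proof (rule nonneg_from_end[OF x, where g="\<lambda>y. S y * S x - f x * S1 y"])
    fix z assume z: "z \<in> D" "x \<le> z"
    show "((\<lambda>y. S y * S x - f x * S1 y) has_real_derivative f x * S z - f z * S x) (at z)"
      by (rule derivative_eq_intros tail_derivs z refl)+ (simp add: algebra_simps)
    show "f x * S z - f z * S x \<le> 0"
      using hazard_mono[of x z] x z by (simp add: S_def D_def)
  next
    fix u assume "exhausts u"
    then have "(\<lambda>n. S (u n) * S x - f x * S1 (u n)) \<longlonglongrightarrow> 0 * S x - f x * 0"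
      by (intro tendsto_intros exhausts_tendsto)
    then show "\<exists>h. h \<longlonglongrightarrow> 0 \<and> (\<forall>\<^sub>F n in sequentially. h n \<le> S (u n) * S x - f x * S1 (u n))"
      by (intro exI[of _ "\<lambda>n. S (u n) * S x - f x * S1 (u n)"]) auto
  qed
  then show ?thesis by (simp add: power2_eq_square)
qed

lemma mean_residual_life_antimono: 
  assumes x: "x \<in> D" "x \<le> y" "y \<in> D" shows "S1 y * S x \<le> S1 x * S y"
proof -
  have "S1 y / S y \<le> S1 x / S x"
  proof (rule DERIV_nonpos_imp_nonincreasing[OF x(2)])
    fix z assume z: "x \<le> z" "z \<le> y"
    have zD: "z \<in> D" by (rule D_convex[OF x(3)]) (use z D_bounds(1)[OF x(1)] in auto)
    have p: "0 < S z" by (rule S_pos[OF zD])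
    have "((\<lambda>y. S1 y / S y) has_real_derivative (f z * S1 z - (S z)\<^sup>2) / (S z)\<^sup>2) (at z)"
      by (rule derivative_eq_intros tail_derivs zD refl)+ (use p in \<open>auto simp: power2_eq_square field_simps\<close>)
    moreover have "(f z * S1 z - (S z)\<^sup>2) / (S z)\<^sup>2 \<le> 0"
      using S_square_ge[OF zD] by (intro divide_nonpos_nonneg) auto
    ultimately show "\<exists>d. ((\<lambda>y. S1 y / S y) has_real_derivative d) (at z) \<and> d \<le> 0" by blast
  qed
  then show ?thesis using S_pos[OF x(1)] S_pos[OF x(3)] by (simp add: field_simps)
qed

lemma S_S2_le: assumes x: "x \<in> D" shows "S x * S2 x \<le> (S1 x)\<^sup>2"
proof -
  have "0 \<le> S1 x * S1 x - S x * S2 x"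
  proof (rule nonneg_from_end[OF x, where g="\<lambda>y. S1 y * S1 x - S x * S2 y"])
    fix z assume z: "z \<in> D" "x \<le> z"
    show "((\<lambda>y. S1 y * S1 x - S x * S2 y) has_real_derivative S1 z * S x - S1 x * S z) (at z)"
      by (rule derivative_eq_intros tail_derivs z refl)+ (simp add: algebra_simps)
    show "S1 z * S x - S1 x * S z \<le> 0"
      using mean_residual_life_antimono[OF x z(2,1)] by simp
  next
    fix u assume "exhausts u"
    then have "(\<lambda>n. S1 (u n) * S1 x - S x * S2 (u n)) \<longlonglongrightarrow> 0 * S1 x - S x * 0"
      by (intro tendsto_intros exhausts_tendsto)
    then show "\<exists>h. h \<longlonglongrightarrow> 0 \<and> (\<forall>\<^sub>F n in sequentially. h n \<le> S1 (u n) * S1 x - S x * S2 (u n))"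
      by (intro exI[of _ "\<lambda>n. S1 (u n) * S1 x - S x * S2 (u n)"]) auto
  qed
  then show ?thesis by (simp add: power2_eq_square)
qed

lemma exhausts_S_at_right: assumes u: "exhausts u" shows "filterlim (\<lambda>n. S (u n)) (at_right 0) sequentially"
  using exhausts_S[OF u] u
  by (auto simp: filterlim_at exhausts_def S_pos intro!: always_eventually less_imp_neq[symmetric])

lemma exhausts_S_ln_S: assumes u: "exhausts u" shows "(\<lambda>n. S (u n) * ln (S (u n))) \<longlonglongrightarrow> 0"
proof -
  have "((\<lambda>x::real. x * ln x) \<longlongrightarrow> 0) (at_right 0)" by real_asymp
  from filterlim_compose[OF this exhausts_S_at_right[OF u]] show ?thesis .
qed

text \<open>Concavity of the logarithm on $[1,2]$ and $\log 2 \ge 2/3$.\<close>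

lemma ln_chord: assumes "1 \<le> u" "u \<le> (2::real)" shows "2/3 * (u - 1) \<le> ln u"
proof -
  have "ln 2 * (u - 1) \<le> ln u"
  proof -
    have c: "concave_on {0<..} (ln::real\<Rightarrow>real)"
      by (rule ln_concave)
    have "(1 - (u - 1)) * ln 1 + (u - 1) * ln 2 \<le> ln ((1 - (u - 1)) *\<^sub>R 1 + (u - 1) *\<^sub>R (2::real))"
      using assms by (intro concave_onD[OF c]) auto
    then show ?thesis by (simp add: mult.commute)
  qed
  moreover have "2/3 \<le> ln (2::real)" using ln2_ge_two_thirds .
  ultimately show ?thesis using assms mult_right_mono[of "2/3" "ln 2" "u - 1"] by linarith
qed

text \<open>With $u = S^2/(f S_1)$ and $R = S S_2/S_1^2$ the derivative of the right-hand side is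
$f\,(2(u-1)(1-R) - \log u)$. The inequalities above put $u$ into $[1,2]$ and $R$ above $2/3$, and then
$2(u-1)(1-R) \le \frac{2}{3}(u-1) \le \log u$. The expression itself arises by integrating
$f \log (S/f)$: write $S/f = u\,S_1/S$ and replace $\log u$ by the bound $2(u-1)(1-R)$, which makes the
integrand an exact derivative.\<close>

lemma entropy_ge_on: assumes x: "x \<in> D"
  shows "0 \<le> N x + 2 * S x * ln (S x) - S x * ln (S1 x) - S2 x * (S x / S1 x)\<^sup>2"
proof (rule nonneg_from_end[OF x])
  fix z assume z: "z \<in> D" "x \<le> z"
  note p = S_pos[OF z(1)] S1_pos[OF z(1)] D_bounds(2)[OF z(1)]
  define u where "u = (S z)\<^sup>2 / (f z * S1 z)"
  define R where "R = S z * S2 z / (S1 z)\<^sup>2"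
  have lnu: "ln u = 2 * ln (S z) - ln (f z) - ln (S1 z)"
    using p by (simp add: u_def ln_div ln_mult ln_realpow)
  show "((\<lambda>x. N x + 2 * S x * ln (S x) - S x * ln (S1 x) - S2 x * (S x / S1 x)\<^sup>2)
     has_real_derivative f z * (2 * (u - 1) * (1 - R) - ln u)) (at z)"
    unfolding lnu
    by (rule derivative_eq_intros tail_derivs z refl p)+
       (use p in simp_all, simp add: u_def R_def field_simps power2_eq_square)
  have u: "1 \<le> u" "u \<le> 2"
    using S_square_ge[OF z(1)] S_square_le[OF z(1) order_refl z(1)] p by (simp_all add: u_def field_simps)
  have "2 / 3 \<le> R" using S1_square_le[OF z(1)] p by (simp add: R_def field_simps)
  then have "2 * (u - 1) * (1 - R) \<le> 2 * (u - 1) * (1 / 3)" using u by (intro mult_left_mono) auto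
  also have "\<dots> \<le> ln u" using ln_chord[OF u] by simp
  finally show "f z * (2 * (u - 1) * (1 - R) - ln u) \<le> 0" using p by (intro mult_nonneg_nonpos) auto
next
  fix u assume u: "exhausts u"
  \<comment> \<open>Near the end \<open>S1 < 1\<close>, so the term with \<open>ln (S1 x)\<close> only helps, and the last term is at most
    \<open>S\<close> by \<open>S_S2_le\<close>.\<close>
  define h where "h n = N (u n) + 2 * (S (u n) * ln (S (u n))) - S (u n)" for n
  have "h \<longlonglongrightarrow> 0 + 2 * 0 - 0"
    unfolding h_def by (intro tendsto_intros exhausts_tendsto exhausts_S_ln_S u)
  moreover have "\<forall>\<^sub>F n in sequentially. h n \<le> N (u n) + 2 * S (u n) * ln (S (u n)) - S (u n) * ln (S1 (u n)) - S2 (u n) * (S (u n) / S1 (u n))\<^sup>2"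
    using order_tendstoD(2)[OF exhausts_S1[OF u] zero_less_one]
  proof eventually_elim
    case (elim n)
    have un: "u n \<in> D" using u by (simp add: exhausts_def)
    note p = S_pos[OF un] S1_pos[OF un]
    have "S (u n) * ln (S1 (u n)) \<le> 0" using p elim by (intro mult_nonneg_nonpos) auto
    moreover have "S2 (u n) * (S (u n) / S1 (u n))\<^sup>2 \<le> S (u n)"
      using mult_left_mono[OF S_S2_le[OF un], of "S (u n)"] p by (simp add: field_simps power2_eq_square)
    ultimately show ?case by (simp add: h_def)
  qed
  ultimately show "\<exists>h. h \<longlonglongrightarrow> 0 \<and> (\<forall>\<^sub>F n in sequentially. h n \<le> N (u n) + 2 * S (u n) * ln (S (u n)) - S (u n) * ln (S1 (u n)) - S2 (u n) * (S (u n) / S1 (u n))\<^sup>2)"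
    by auto
qed

end

section \<open>Entropy against mean distance on a half-line\<close>

text \<open>The mean bound asserts that the average of \<open>excess a\<close> is at most 0 when \<open>a\<close> is the normalised
reciprocal hazard rate, regarded as a function of the tail mass $s \in [0,1]$. There \<open>a\<close> increases
and $a/s$ decreases. The function \<open>excess\<close> decreases up to $1/2$ and increases afterwards; if \<open>a\<close>
crosses the level $1/2$ at $s_1$, then $\min(1, s/(2 s_1))$ lies further from $1/2$ on the
same side, hence has the larger excess, and its average excess is 0.\<close>

definition excess :: "real \<Rightarrow> real" where "excess a = 2 * a - 2 - ln a"

lemma excess_antimono: assumes "0 < a" "a \<le> b" "b \<le> 1/2" shows "excess b \<le> excess a"
proof -
  have "ln (a / b) \<le> a / b - 1" using assms by (intro ln_le_minus_one) auto
  then have "ln a - ln b \<le> - ((b - a) / b)" using assms by (simp add: ln_div diff_divide_distrib)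
  moreover have "2 * (b - a) \<le> (b - a) / b" 
    using mult_left_mono[of "2 * b" 1 "b - a"] assms by (simp add: field_simps)
  ultimately show ?thesis by (simp add: excess_def)
qed

lemma excess_mono: assumes "1/2 \<le> a" "a \<le> b" shows "excess a \<le> excess b"
proof -
  have "ln (b / a) \<le> b / a - 1" using assms by (intro ln_le_minus_one) auto
  then have "ln b - ln a \<le> (b - a) / a" using assms by (simp add: ln_div diff_divide_distrib)
  moreover have "(b - a) / a \<le> 2 * (b - a)" 
    using mult_left_mono[of 1 "2 * a" "b - a"] assms by (simp add: field_simps)
  ultimately show ?thesis by (simp add: excess_def)
qed

text \<open>The antiderivative of $s \mapsto$ \<open>excess (min 1 (s / \<kappa>))\<close> that vanishes at 0. It also vanishes
from \<open>\<kappa>\<close> on, which is why the average excess of the comparison function is 0.\<close>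

definition excess_int :: "real \<Rightarrow> real \<Rightarrow> real" where
  "excess_int \<kappa> s = (if s \<le> \<kappa> then s\<^sup>2 / \<kappa> - s - s * ln (s / \<kappa>) else 0)"

lemma excess_int_deriv:
  assumes k: "0 < \<kappa>" and s: "0 < s"
  shows "(excess_int \<kappa> has_real_derivative excess (min 1 (s / \<kappa>))) (at s)"
proof -
  define A where "A s = s\<^sup>2 / \<kappa> - s - s * ln (s / \<kappa>)" for s
  have A: "(A has_real_derivative excess (s / \<kappa>)) (at s)"
    unfolding A_def[abs_def] excess_def
    using k s by (auto intro!: derivative_eq_intros simp: divide_simps) (simp add: algebra_simps)
  \<comment> \<open>The two branches meet at \<open>\<kappa>\<close> with value 0 and slope 0.\<close>
  consider "s < \<kappa>" | "s > \<kappa>" | "s = \<kappa>" by linarith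
  then show ?thesis
  proof cases
    case 1
    have ev: "\<forall>\<^sub>F t in nhds s. A t = excess_int \<kappa> t"
      using eventually_nhds_in_open[of "{..<\<kappa>}" s] 1
      by (auto elim!: eventually_mono simp: A_def excess_int_def)
    show ?thesis using iffD1[OF DERIV_cong_ev[OF refl ev refl] A] 1 k by (simp add: min_def)
  next
    case 2
    have ev: "\<forall>\<^sub>F t in nhds s. 0 = excess_int \<kappa> t"
      using eventually_nhds_in_open[of "{\<kappa><..}" s] 2
      by (auto elim!: eventually_mono simp: excess_int_def)
    show ?thesis using iffD1[OF DERIV_cong_ev[OF refl ev refl] DERIV_const] 2 k by (simp add: min_def excess_def)
  next
    case 3
    have e0: "excess (min 1 (s / \<kappa>)) = 0" "excess (s / \<kappa>) = 0" "excess_int \<kappa> s = 0" "A s = 0"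
      using 3 k by (auto simp: excess_def excess_int_def A_def power2_eq_square)
    have "((\<lambda>t. (A t - A s) / (t - s)) \<longlongrightarrow> 0) (at_left s)"
      using A unfolding has_field_derivative_iff e0 by (rule filterlim_mono) (auto simp: at_le)
    moreover have "\<forall>\<^sub>F t in at_left s. t < s" by (simp add: eventually_at_filter)
    then have "\<forall>\<^sub>F t in at_left s. (A t - A s) / (t - s) = (excess_int \<kappa> t - excess_int \<kappa> s) / (t - s)"
      unfolding e0 by (rule eventually_mono) (use 3 in \<open>simp add: A_def excess_int_def\<close>)
    ultimately have L: "((\<lambda>t. (excess_int \<kappa> t - excess_int \<kappa> s) / (t - s)) \<longlongrightarrow> 0) (at_left s)"
      by (rule Lim_transform_eventually)
    have "\<forall>\<^sub>F t in at_right s. t > s" by (simp add: eventually_at_filter)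
    then have "\<forall>\<^sub>F t in at_right s. (excess_int \<kappa> t - excess_int \<kappa> s) / (t - s) = 0"
      unfolding e0 by (rule eventually_mono) (use 3 in \<open>simp add: excess_int_def\<close>)
    then have "((\<lambda>t. (excess_int \<kappa> t - excess_int \<kappa> s) / (t - s)) \<longlongrightarrow> 0) (at_right s)"
      by (rule tendsto_eventually)
    with L show ?thesis unfolding has_field_derivative_iff e0(1) by (simp add: filterlim_split_at)
  qed
qed

lemma excess_int_tendsto_0: assumes "0 < \<kappa>" shows "(excess_int \<kappa> \<longlongrightarrow> 0) (at_right 0)"
proof -
  have "((\<lambda>s. s\<^sup>2 / \<kappa> - s - s * ln (s / \<kappa>)) \<longlongrightarrow> 0) (at_right 0)" using assms by real_asymp
  moreover have "\<forall>\<^sub>F s in at_right 0. s\<^sup>2 / \<kappa> - s - s * ln (s / \<kappa>) = excess_int \<kappa> s"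
    using eventually_at_right_real[OF assms] by eventually_elim (simp add: excess_int_def)
  ultimately show ?thesis by (rule Lim_transform_eventually)
qed

context log_concave_half_line begin

lemma mode_pos: assumes "D \<noteq> {}" shows "0 < S c" "0 < S1 c" "0 < H"
proof -
  obtain d where d: "d \<in> D" using assms by blast
  show "0 < S c"
    unfolding S_def using D_bounds[OF d] isCont_f[OF d]
    by (intro tail_pos[OF f_integrable f_nonneg, of c d]) auto
  show "0 < S1 c"
    unfolding S1_tail using D_bounds[OF d] isCont_f[OF d]
    by (intro tail_pos[OF shifted_moment1_integrable, of c c d]) (auto simp: f_nonneg)
  show "0 < H" using D_bounds[OF d] f_le[of d] by simp
qed

text \<open>The reciprocal hazard rate \<open>S / f\<close>, divided by its value \<open>S c / H\<close> at the mode.\<close>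

definition ratio :: "real \<Rightarrow> real" where "ratio y = S y * H / (S c * f y)"

lemma ratio_bounds: assumes y: "y \<in> D" shows "0 < ratio y" "ratio y \<le> 1"
proof -
  have ne: "D \<noteq> {}" using y by blast
  note p = mode_pos[OF ne] S_pos[OF y] D_bounds[OF y]
  show "0 < ratio y" using p by (simp add: ratio_def)
  show "ratio y \<le> 1" using hazard_ge[of y] p by (simp add: ratio_def field_simps S_def)
qed

lemma ratio_antimono: assumes x: "x \<in> D" "y \<in> D" "x \<le> y" shows "ratio y \<le> ratio x"
proof -
  have ne: "D \<noteq> {}" using x by blast
  note p = mode_pos[OF ne] D_bounds[OF x(1)] D_bounds[OF x(2)]
  have "S y * f x \<le> S x * f y" using hazard_mono[of x y] p x by (simp add: S_def mult.commute)
  then have "S y * f x * (H * S c) \<le> S x * f y * (H * S c)" using p by (intro mult_right_mono) auto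
  then show ?thesis using p by (simp add: ratio_def field_simps)
qed

lemma ln_ratio: assumes y: "y \<in> D" shows "ln (ratio y) = ln (S y) + ln (H / S c) - ln (f y)"
proof -
  have ne: "D \<noteq> {}" using y by blast
  note p = mode_pos[OF ne] S_pos[OF y] D_bounds[OF y]
  show ?thesis using p by (simp add: ratio_def ln_div ln_mult)
qed

text \<open>The inequality \<open>ln (ratio y) \<le> 0\<close>, integrated against \<open>f\<close>; at the mode it says that the entropy
deficit is nonnegative.\<close>

lemma entropy_le_on: assumes x: "x \<in> D"
  shows "0 \<le> S x - N x - S x * ln (S x) - S x * ln (H / S c)"
proof (rule nonneg_from_end[OF x, where g = "\<lambda>x. S x - N x - S x * ln (S x) - S x * ln (H / S c)"])
  fix z assume z: "z \<in> D" "x \<le> z"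
  note p = S_pos[OF z(1)] D_bounds(2)[OF z(1)]
  show "((\<lambda>x. S x - N x - S x * ln (S x) - S x * ln (H / S c)) has_real_derivative f z * ln (ratio z)) (at z)"
    unfolding ln_ratio[OF z(1)]
    by (rule derivative_eq_intros tail_derivs z refl p)+ (use p in \<open>auto simp: field_simps\<close>)
  show "f z * ln (ratio z) \<le> 0" using p ratio_bounds[OF z(1)] by (intro mult_nonneg_nonpos) auto
next
  fix u assume u: "exhausts u"
  have "(\<lambda>n. S (u n) - N (u n) - S (u n) * ln (S (u n)) - S (u n) * ln (H / S c)) \<longlonglongrightarrow> 0 - 0 - 0 - 0 * ln (H / S c)"
    by (intro tendsto_intros exhausts_tendsto exhausts_S_ln_S u)
  then show "\<exists>h. h \<longlonglongrightarrow> 0 \<and> (\<forall>\<^sub>F n in sequentially. h n \<le> S (u n) - N (u n) - S (u n) * ln (S (u n)) - S (u n) * ln (H / S c))"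
    by (intro exI[of _ "\<lambda>n. S (u n) - N (u n) - S (u n) * ln (S (u n)) - S (u n) * ln (H / S c)"]) auto
qed

text \<open>Integrates a pointwise bound for the excess that depends on \<open>y\<close> only through the tail mass
\<open>S y\<close>; such a bound has the explicit antiderivative \<open>K (S y)\<close>.\<close>

lemma entropy_compare_on: 
  assumes x: "x \<in> D"
    and K: "\<And>s. 0 < s \<Longrightarrow> (K has_real_derivative k s) (at s)" "(K \<longlongrightarrow> 0) (at_right 0)"
    and le: "\<And>y. y \<in> D \<Longrightarrow> excess (ratio y) \<le> k (S y)"
  shows "0 \<le> K (S x) + S x * ln (S x) + S x + S x * ln (H / S c) + N x - 2 * (H / S c) * S1 x"
proof (rule nonneg_from_end[OF x, where g="\<lambda>x. K (S x) + S x * ln (S x) + S x + S x * ln (H / S c) + N x - 2 * (H / S c) * S1 x"])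
  fix z assume z: "z \<in> D" "x \<le> z"
  note p = S_pos[OF z(1)] D_bounds(2)[OF z(1)]
  have "D \<noteq> {}" using x by blast
  note m = mode_pos[OF this]
  have r: "excess (ratio z) * f z = 2 * (H / S c) * S z - (2 + ln (S z) + ln (H / S c) - ln (f z)) * f z"
    unfolding excess_def ln_ratio[OF z(1)] using p m by (simp add: ratio_def field_simps)
  show "((\<lambda>x. K (S x) + S x * ln (S x) + S x + S x * ln (H / S c) + N x - 2 * (H / S c) * S1 x) has_real_derivative
      excess (ratio z) * f z - k (S z) * f z) (at z)"
    unfolding r
    by (rule derivative_eq_intros tail_derivs z refl p DERIV_chain2[OF K(1)])+ (use p in \<open>auto simp: algebra_simps\<close>)
  show "excess (ratio z) * f z - k (S z) * f z \<le> 0"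
    using mult_right_mono[OF le[OF z(1)], of "f z"] p by simp
next
  fix u assume u: "exhausts u"
  have "(\<lambda>n. K (S (u n)) + S (u n) * ln (S (u n)) + S (u n) + S (u n) * ln (H / S c) + N (u n) - 2 * (H / S c) * S1 (u n))
     \<longlonglongrightarrow> 0 + 0 + 0 + 0 * ln (H / S c) + 0 - 2 * (H / S c) * 0"
    by (intro tendsto_intros exhausts_tendsto exhausts_S_ln_S u filterlim_compose[OF K(2) exhausts_S_at_right])
  then show "\<exists>h. h \<longlonglongrightarrow> 0 \<and> (\<forall>\<^sub>F n in sequentially. h n \<le> K (S (u n)) + S (u n) * ln (S (u n)) + S (u n) + S (u n) * ln (H / S c) + N (u n) - 2 * (H / S c) * S1 (u n))"
    by (intro exI[of _ "\<lambda>n. K (S (u n)) + S (u n) * ln (S (u n)) + S (u n) + S (u n) * ln (H / S c) + N (u n) - 2 * (H / S c) * S1 (u n)"]) auto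
qed

text \<open>The comparison function for the excess. As \<open>ratio y\<close> equals \<open>S y\<close> times a constant over \<open>f y\<close>,
comparing it with \<open>S y / \<kappa>\<close> amounts to comparing \<open>f y\<close> with the level \<open>\<phi>\<close>, and \<open>\<phi>\<close> is the value of
the density where the ratio drops below $1/2$. A supremum replaces that value, so that no crossing
point has to be found. If the ratio never drops below $1/2$, its excess is nonpositive throughout.\<close>

lemma comparison_exists:
  assumes ne: "D \<noteq> {}"
  obtains K k where "\<And>s. 0 < s \<Longrightarrow> (K has_real_derivative k s) (at s)" "(K \<longlongrightarrow> 0) (at_right 0)"
    "\<And>y. y \<in> D \<Longrightarrow> excess (ratio y) \<le> k (S y)" "K (S c) = 0"
proof (cases "\<forall>y\<in>D. 1/2 \<le> ratio y")
  case True
  have "excess (ratio y) \<le> 0" if "y \<in> D" for y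
    using excess_mono[of "ratio y" 1] True ratio_bounds[OF that] that by (auto simp: excess_def)
  then show ?thesis
    by (intro that[of "\<lambda>_. 0" "\<lambda>_. 0"]) auto
next
  case False
  define E where "E = {y \<in> D. ratio y < 1/2}"
  define \<phi> where "\<phi> = (SUP y\<in>E. f y)"
  obtain e where e: "e \<in> E" using False by (auto simp: E_def not_le)
  have bdd: "bdd_above (f ` E)" using f_le by (auto simp: bdd_above_def)
  have up: "f y \<le> \<phi>" if "y \<in> E" for y unfolding \<phi>_def using bdd that by (rule cSUP_upper2) simp
  have lo: "\<phi> \<le> f y" if "y \<in> D" "y \<notin> E" for y
    unfolding \<phi>_def
  proof (rule cSUP_least)
    fix z assume z: "z \<in> E"
    then have "\<not> z \<le> y" using ratio_antimono[of z y] that by (auto simp: E_def)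
    then show "f z \<le> f y" using z that D_bounds by (intro f_antimono) (auto simp: E_def)
  qed (use e in auto)
  have "0 < f e" using e D_bounds by (auto simp: E_def)
  then have \<phi>: "0 < \<phi>" using up[OF e] by simp
  have "\<phi> \<le> H" unfolding \<phi>_def using e f_le by (intro cSUP_least) auto
  note m = mode_pos[OF ne]
  define \<kappa> where "\<kappa> = S c * \<phi> / H"
  have k: "0 < \<kappa>" "\<kappa> \<le> S c" using m \<phi> \<open>\<phi> \<le> H\<close> by (auto simp: \<kappa>_def field_simps)
  have q: "S y / \<kappa> = ratio y * (f y / \<phi>)" if "y \<in> D" for y
    using m \<phi> D_bounds[OF that] by (simp add: \<kappa>_def ratio_def field_simps)
  have "excess (ratio y) \<le> excess (min 1 (S y / \<kappa>))" if y: "y \<in> D" for y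
  proof (cases "y \<in> E")
    case True
    have "S y / \<kappa> \<le> ratio y"
      unfolding q[OF y] using mult_left_mono[of "f y / \<phi>" 1 "ratio y"] up[OF True] \<phi> ratio_bounds[OF y] by simp
    moreover have "ratio y < 1/2" using True by (simp add: E_def)
    moreover have "0 < S y / \<kappa>" using S_pos[OF y] k by simp
    ultimately show ?thesis by (intro excess_antimono) auto
  next
    case False
    have "ratio y \<le> S y / \<kappa>"
      unfolding q[OF y] using mult_left_mono[of 1 "f y / \<phi>" "ratio y"] lo[OF y False] \<phi> ratio_bounds[OF y] by simp
    moreover have "1/2 \<le> ratio y" using False y by (simp add: E_def)
    ultimately show ?thesis using ratio_bounds[OF y] by (intro excess_mono) auto
  qed
  moreover have "excess_int \<kappa> (S c) = 0" using k by (auto simp: excess_int_def power2_eq_square)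
  ultimately show ?thesis
    using excess_int_deriv[OF k(1)] excess_int_tendsto_0[OF k(1)]
    by (intro that[of "excess_int \<kappa>" "\<lambda>s. excess (min 1 (s / \<kappa>))"]) auto
qed

lemma entropy_ge_mean: assumes ne: "D \<noteq> {}" 
  shows "2 * (H / S c) * S1 c - S c - S c * ln H \<le> N c"
proof -
  note m = mode_pos[OF ne]
  obtain K k where K: "\<And>s. 0 < s \<Longrightarrow> (K has_real_derivative k s) (at s)" "(K \<longlongrightarrow> 0) (at_right 0)"
    "\<And>y. y \<in> D \<Longrightarrow> excess (ratio y) \<le> k (S y)" "K (S c) = 0"
    using comparison_exists[OF ne] by metis
  have Kc: "isCont K (S c)" using DERIV_isCont[OF K(1)[OF m(1)]] .
  have "0 \<le> K (S c) + S c * ln (S c) + S c + S c * ln (H / S c) + N c - 2 * (H / S c) * S1 c"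
  proof (rule nonneg_at_mode[OF ne,
      where g="\<lambda>x. K (S x) + S x * ln (S x) + S x + S x * ln (H / S c) + N x - 2 * (H / S c) * S1 x"])
    show "isCont (\<lambda>x. K (S x) + S x * ln (S x) + S x + S x * ln (H / S c) + N x - 2 * (H / S c) * S1 x) c"
      using m by (intro continuous_intros S_cont N_cont S1_cont isCont_o2[OF S_cont Kc]) auto
  qed (rule entropy_compare_on[OF _ K(1-3)])
  then show ?thesis using m K(4) by (simp add: ln_div algebra_simps)
qed

lemma entropy_le: assumes ne: "D \<noteq> {}" shows "N c \<le> S c * (1 - ln H)"
proof -
  note m = mode_pos[OF ne]
  have "0 \<le> S c - N c - S c * ln (S c) - S c * ln (H / S c)"
  proof (rule nonneg_at_mode[OF ne,
      where g="\<lambda>x. S x - N x - S x * ln (S x) - S x * ln (H / S c)"])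
    show "isCont (\<lambda>x. S x - N x - S x * ln (S x) - S x * ln (H / S c)) c"
      using m by (intro continuous_intros S_cont N_cont) auto
  qed (rule entropy_le_on)
  then show ?thesis using m by (simp add: ln_div algebra_simps)
qed

lemma entropy_ge: assumes ne: "D \<noteq> {}" shows "- (S c * ln H) \<le> N c"
proof -
  note m = mode_pos[OF ne]
  have "tail (\<lambda>y. f y * ln (f y)) c \<le> tail (\<lambda>y. ln H * f y) c"
  proof (rule tail_mono[OF entropy_integrable integrable_mult_right[OF f_integrable]])
    fix y show "f y * ln (f y) \<le> ln H * f y"
      using f_nonneg[of y] f_le[of y] m by (cases "f y = 0") (auto simp: mult.commute intro!: mult_right_mono)
  qed
  also have "\<dots> = ln H * tail f c" using tail_lincomb[OF f_integrable f_integrable, of "ln H" 0] by simp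
  finally show ?thesis by (simp add: N_def S_def mult.commute)
qed

text \<open>The second inequality bounds the conditional variance from below by a third of the squared mean
distance; it makes the variance positive, so that its logarithm is meaningful.\<close>

lemma entropy_ge_variance: assumes ne: "D \<noteq> {}" 
  shows "S c * ln (S1 c / (S c)\<^sup>2) + S2 c * (S c / S1 c)\<^sup>2 \<le> N c"
    and "2 * (S1 c)\<^sup>2 \<le> 3 * S c * S2 c"
proof -
  note m = mode_pos[OF ne]
  have "0 \<le> N c + 2 * S c * ln (S c) - S c * ln (S1 c) - S2 c * (S c / S1 c)\<^sup>2"
  proof (rule nonneg_at_mode[OF ne])
    show "isCont (\<lambda>x. N x + 2 * S x * ln (S x) - S x * ln (S1 x) - S2 x * (S x / S1 x)\<^sup>2) c"
      using m by (intro continuous_intros S_cont S1_cont S2_cont N_cont) auto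
  qed (rule entropy_ge_on)
  then show "S c * ln (S1 c / (S c)\<^sup>2) + S2 c * (S c / S1 c)\<^sup>2 \<le> N c"
    using m by (simp add: ln_div ln_realpow algebra_simps)
  have "0 \<le> 3 * S c * S2 c - 2 * (S1 c)\<^sup>2"
  proof (rule nonneg_at_mode[OF ne])
    show "isCont (\<lambda>x. 3 * S x * S2 x - 2 * (S1 x)\<^sup>2) c"
      by (intro continuous_intros S_cont S1_cont S2_cont)
  qed (use S1_square_le in simp)
  then show "2 * (S1 c)\<^sup>2 \<le> 3 * S c * S2 c" by simp
qed

lemma tail_eq_0_if_D_empty: 
  assumes "D = {}" "\<And>y. f y = 0 \<Longrightarrow> g y = 0" shows "tail g c = 0"
proof -
  have "f y = 0" if "c < y" for y using assms(1) that f_nonneg[of y] by (auto simp: D_def le_less)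
  then have "AE y in lborel. indicat_real {c..} y *\<^sub>R g y = 0"
    using AE_lborel_singleton[of c] assms(2) by (auto elim!: eventually_mono simp: indicator_def)
  then show ?thesis unfolding tail_def set_lebesgue_integral_def
    by (rule integral_eq_zero_AE)
qed

text \<open>Summary of the half-line in terms of the entropy deficit \<open>x\<close>, the conditional mean distance \<open>m\<close> and
the conditional variance \<open>s\<close>. For the mean, $1 - x/2 \le e^{-x/2}$ puts the linear bound into
exponential form. For the variance, the estimate obtained is
$\log (m/S) + \frac{1}{2} + \frac{s}{2m^2} \le 1 - \log H - x$, and
$\log (s/m^2) \le s/m^2 - 1$ eliminates \<open>m\<close>.\<close>

proposition half_line_bounds:
  obtains x m s where "0 \<le> x" "x \<le> 1" "0 \<le> m" "0 \<le> s" "0 < S c \<longrightarrow> 0 < s"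
    "N c = S c * (1 - ln H - x)" "S1 c = S c * m" "2 * S2 c = S c * (s + m\<^sup>2)"
    "H * m \<le> S c * exp (- x / 2)" "H\<^sup>2 * s \<le> (S c)\<^sup>2 * exp (- 2 * x)"
proof (cases "D = {}")
  case True
  then have "S c = 0" "S1 c = 0" "S2 c = 0" "N c = 0"
    by (simp_all add: S_def S1_def S2_def N_def tail_eq_0_if_D_empty)
  then show ?thesis by (intro that[of 0 0 0]) auto
next
  case ne: False
  note p = mode_pos[OF ne]
  define x where "x = 1 - ln H - N c / S c"
  define m where "m = S1 c / S c"
  define s where "s = 2 * S2 c / S c - m\<^sup>2"
  have N: "N c = S c * (1 - ln H - x)" using p by (simp add: x_def)
  have S1: "S1 c = S c * m" using p by (simp add: m_def)
  have S2: "2 * S2 c = S c * (s + m\<^sup>2)" using p by (simp add: s_def)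
  have m: "0 < m" using p by (simp add: m_def)
  have x: "0 \<le> x" using entropy_le[OF ne] p unfolding N by simp
  have x1: "x \<le> 1" 
  proof -
    have "S c * (- ln H) \<le> S c * (1 - ln H - x)" using entropy_ge[OF ne] unfolding N by simp
    then have "- ln H \<le> 1 - ln H - x" using p(1) by (simp only: mult_le_cancel_left_pos)
    then show ?thesis by simp
  qed
  have "m\<^sup>2 / 3 \<le> s"
  proof -
    have "4 * (S1 c)\<^sup>2 \<le> 3 * S c * (2 * S2 c)" using entropy_ge_variance(2)[OF ne] by simp
    then have "4 * (S c * m)\<^sup>2 \<le> 3 * S c * (S c * (s + m\<^sup>2))" unfolding S1 S2 .
    then have "(S c)\<^sup>2 * (4 * m\<^sup>2) \<le> (S c)\<^sup>2 * (3 * (s + m\<^sup>2))" by (simp add: power2_eq_square algebra_simps)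
    then show ?thesis using p by simp
  qed
  moreover have "0 < m\<^sup>2" using m by simp
  ultimately have s: "0 < s" by linarith
  have mx: "H * m \<le> S c * exp (- x / 2)"
  proof -
    have "2 * (H / S c) * (S c * m) - S c - S c * ln H \<le> S c * (1 - ln H - x)"
      using entropy_ge_mean[OF ne] unfolding N S1 .
    then have "H * m \<le> S c * (1 + - x / 2)" using p by (simp add: algebra_simps)
    also have "\<dots> \<le> S c * exp (- x / 2)" using p by (intro mult_left_mono exp_ge_add_one_self) auto
    finally show ?thesis .
  qed
  have "S c * ln (S c * m / (S c)\<^sup>2) + S2 c * (S c / (S c * m))\<^sup>2 \<le> S c * (1 - ln H - x)"
    using entropy_ge_variance(1)[OF ne] unfolding N S1 .
  moreover have "S2 c * (S c / (S c * m))\<^sup>2 = S c * ((s + m\<^sup>2) / (2 * m\<^sup>2))"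
    using S2 p m by (simp add: field_simps power2_eq_square)
  ultimately have "S c * (ln (m / S c) + (s + m\<^sup>2) / (2 * m\<^sup>2)) \<le> S c * (1 - ln H - x)"
    using p by (simp add: power2_eq_square distrib_left)
  then have "ln (m / S c) + (s + m\<^sup>2) / (2 * m\<^sup>2) \<le> 1 - ln H - x" using p by simp
  moreover have "(s + m\<^sup>2) / (2 * m\<^sup>2) = s / m\<^sup>2 / 2 + 1 / 2" using m by (simp add: field_simps)
  moreover have "ln (s / m\<^sup>2) \<le> s / m\<^sup>2 - 1" using s m by (intro ln_le_minus_one) auto
  ultimately have "ln s + 2 * ln H \<le> 2 * ln (S c) - 2 * x" using s m p by (simp add: ln_div ln_realpow)
  then have "ln (H\<^sup>2 * s) \<le> ln ((S c)\<^sup>2 * exp (- 2 * x))" using s p by (simp add: ln_mult ln_realpow)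
  then have sx: "H\<^sup>2 * s \<le> (S c)\<^sup>2 * exp (- 2 * x)" using s p by (subst (asm) ln_le_cancel_iff) auto
  show ?thesis by (rule that[OF x x1 less_imp_le[OF m] less_imp_le[OF s] impI[OF s] N S1 S2 mx sx])
qed

end

section \<open>The inequality that joins the two half-lines\<close>

text \<open>An exponential of an affine function is convex in each variable, hence below the bilinear
interpolation of its values at the corners of the unit square.\<close>

lemma exp_le_bilinear:
  fixes a b d x y :: real
  assumes "0 \<le> x" "x \<le> 1" "0 \<le> y" "y \<le> 1"
  shows "exp (a + b * x + d * y) \<le> (1 - x) * (1 - y) * exp a + x * (1 - y) * exp (a + b)
    + (1 - x) * y * exp (a + d) + x * y * exp (a + b + d)"
proof -
  have chord: "exp (u + v * t) \<le> (1 - t) * exp u + t * exp (u + v)" if "0 \<le> t" "t \<le> 1" for u v t :: real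
    using convex_onD[OF convex_on_exp[of 1], of t u "u + v"] that by (simp add: algebra_simps)
  have "exp (a + b * x + d * y) \<le> (1 - y) * exp (a + b * x) + y * exp (a + d + b * x)"
    using chord[OF assms(3,4), of "a + b * x" d] by (simp add: add_ac)
  also have "\<dots> \<le> (1 - y) * ((1 - x) * exp a + x * exp (a + b)) + y * ((1 - x) * exp (a + d) + x * exp (a + d + b))"
    using assms by (intro add_mono mult_left_mono chord) auto
  finally show ?thesis by (simp add: algebra_simps)
qed

text \<open>The corner at which one side decays exponentially and the other is flat. Equality holds at $p = 0$
and at $p = 1$, so the exponential factors are cancelled against $e^{-2p}$ near the first end and
against $e^{2q}$ near the second; after that, Taylor polynomials and crude decimal bounds suffice.\<close>

lemma corner_bound:
  fixes p q :: real
  assumes pq: "0 \<le> p" "0 \<le> q" "p + q = 1"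
  shows "p ^ 3 * exp (- 2 * q) + q ^ 3 * exp (2 * p)
    + p * q * (p\<^sup>2 * exp (2 * p - 1) + q\<^sup>2 * exp (2 * p) + 2 * p * q * exp (2 * p - 1 / 2)) \<le> 1"
    (is "?C \<le> 1")
proof (cases "p \<le> 1/2")
  case True
  have e: "(5/2::real) \<le> exp 1" using exp_lower_Taylor_quadratic[of "1::real"] by simp
  have e1: "exp (-1::real) \<le> 2/5" using e by (simp add: exp_minus field_simps)
  have e2: "exp (-2::real) \<le> 4/25"
  proof -
    have "exp (-2::real) = exp (-1) * exp (-1)" by (simp add: exp_add[symmetric])
    also have "\<dots> \<le> (2/5) * (2/5)" by (intro mult_mono e1) auto
    finally show ?thesis by simp
  qed
  have eh: "exp (- 1/2::real) \<le> 16/25"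
  proof (rule power2_le_imp_le)
    have "(exp (- 1/2::real))\<^sup>2 = exp (-1)" by (simp add: power2_eq_square exp_add[symmetric])
    then show "(exp (- 1/2::real))\<^sup>2 \<le> (16/25)\<^sup>2" using e1 by (simp add: power2_eq_square)
  qed simp
  have C: "?C * exp (- 2 * p) = p ^ 3 * exp (-2) + q ^ 3
    + p * q * (p\<^sup>2 * exp (-1) + q\<^sup>2 + 2 * p * q * exp (- 1/2))"
  proof -
    have a: "exp (- 2 * q) * exp (- 2 * p) = exp (-2)" "exp (2 * p) * exp (- 2 * p) = 1"
      "exp (2 * p - 1) * exp (- 2 * p) = exp (-1)" "exp (2 * p - 1 / 2) * exp (- 2 * p) = exp (- 1/2)"
      using pq by (simp_all add: exp_add[symmetric])
    have "?C * exp (- 2 * p) = p ^ 3 * (exp (- 2 * q) * exp (- 2 * p)) + q ^ 3 * (exp (2 * p) * exp (- 2 * p))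
      + p * q * (p\<^sup>2 * (exp (2 * p - 1) * exp (- 2 * p)) + q\<^sup>2 * (exp (2 * p) * exp (- 2 * p)) + 
         2 * p * q * (exp (2 * p - 1 / 2) * exp (- 2 * p)))"
      by (simp only: distrib_right distrib_left mult.assoc mult.left_commute)
    then show ?thesis unfolding a by simp
  qed
  also have "\<dots> \<le> p ^ 3 * (4/25) + q ^ 3 + p * q * (p\<^sup>2 * (2/5) + q\<^sup>2 + 2 * p * q * (16/25))"
    using pq e1 e2 eh by (intro add_mono mult_left_mono order_refl) auto
  also have "\<dots> \<le> 1 - 2 * p + 2 * p\<^sup>2 - 4/3 * p ^ 3"
  proof -
    have q: "q = 1 - p" using pq by simp
    have "1 - 2 * p + 2 * p\<^sup>2 - 4/3 * p ^ 3 - (p ^ 3 * (4/25) + q ^ 3 + p * q * (p\<^sup>2 * (2/5) + q\<^sup>2 + 2 * p * q * (16/25)))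
       = p\<^sup>2 * (18/25 - 4/3 * p + 3/25 * p\<^sup>2)"
      unfolding q by (simp add: field_simps power2_eq_square power3_eq_cube)
    moreover have "0 \<le> p\<^sup>2 * (18/25 - 4/3 * p + 3/25 * p\<^sup>2)"
    proof (intro mult_nonneg_nonneg add_nonneg_nonneg)
      show "0 \<le> 18/25 - 4/3 * p" using True by simp
    qed auto
    ultimately show ?thesis by linarith
  qed
  also have "\<dots> \<le> exp (- 2 * p)"
  proof -
    obtain t where "exp (- 2 * p) = (\<Sum>m<4. (- 2 * p) ^ m / fact m) + exp t / fact 4 * (- 2 * p) ^ 4"
      using Maclaurin_exp_le[of "- 2 * p" 4] by auto
    moreover have "0 \<le> exp t / fact 4 * (- 2 * p) ^ 4" by simp
    moreover have "(\<Sum>m<4. (- 2 * p) ^ m / fact m) = 1 - 2 * p + 2 * p\<^sup>2 - 4/3 * p ^ 3"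
      by (simp add: eval_nat_numeral fact_reduce field_simps)
    ultimately show ?thesis by linarith
  qed
  finally have "?C * exp (- 2 * p) \<le> 1 * exp (- 2 * p)" by simp
  then show ?thesis by (rule mult_right_le_imp_le) simp
next
  case False
  then have q2: "q \<le> 1/2" using pq by simp
  have e1: "exp (1::real) \<le> 272/100" using e_less_272 by simp
  have e2: "exp (2::real) \<le> 740/100"
  proof -
    have "exp (2::real) = exp 1 * exp 1" by (simp add: exp_add[symmetric])
    also have "\<dots> \<le> 272/100 * (272/100)" by (intro mult_mono e1) auto
    finally show ?thesis by simp
  qed
  have eh: "exp (3/2::real) \<le> 450/100"
  proof (rule power2_le_imp_le)
    have "(exp (3/2::real))\<^sup>2 = exp 2 * exp 1" by (simp add: power2_eq_square exp_add[symmetric])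
    also have "\<dots> \<le> 740/100 * (272/100)" by (intro mult_mono e1 e2) auto
    finally show "(exp (3/2::real))\<^sup>2 \<le> (450/100)\<^sup>2" by (simp add: power2_eq_square)
  qed simp
  have C: "?C * exp (2 * q) = p ^ 3 + q ^ 3 * exp 2
    + p * q * (p\<^sup>2 * exp 1 + q\<^sup>2 * exp 2 + 2 * p * q * exp (3/2))"
  proof -
    have a: "exp (- 2 * q) * exp (2 * q) = 1" "exp (2 * p) * exp (2 * q) = exp 2"
      "exp (2 * p - 1) * exp (2 * q) = exp 1" "exp (2 * p - 1 / 2) * exp (2 * q) = exp (3/2)"
      using pq by (simp_all add: exp_add[symmetric])
    have "?C * exp (2 * q) = p ^ 3 * (exp (- 2 * q) * exp (2 * q)) + q ^ 3 * (exp (2 * p) * exp (2 * q))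
      + p * q * (p\<^sup>2 * (exp (2 * p - 1) * exp (2 * q)) + q\<^sup>2 * (exp (2 * p) * exp (2 * q)) + 
         2 * p * q * (exp (2 * p - 1 / 2) * exp (2 * q)))"
      by (simp only: distrib_right distrib_left mult.assoc mult.left_commute)
    then show ?thesis unfolding a by simp
  qed
  also have "\<dots> \<le> p ^ 3 + q ^ 3 * (740/100) + p * q * (p\<^sup>2 * (272/100) + q\<^sup>2 * (740/100) + 2 * p * q * (450/100))"
    using pq e1 e2 eh by (intro add_mono mult_left_mono order_refl) auto
  also have "\<dots> \<le> 1 + 2 * q + 2 * q\<^sup>2"
  proof -
    have p: "p = 1 - q" using pq by simp
    have "1 + 2 * q + 2 * q\<^sup>2 - (p ^ 3 + q ^ 3 * (740/100) + p * q * (p\<^sup>2 * (272/100) + q\<^sup>2 * (740/100) + 2 * p * q * (450/100)))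
       = q * (228/100 - 184/100 * q - 396/100 * q\<^sup>2 + 112/100 * q ^ 3)"
      unfolding p by (simp add: field_simps power2_eq_square power3_eq_cube)
    moreover have "0 \<le> q * (228/100 - 184/100 * q - 396/100 * q\<^sup>2 + 112/100 * q ^ 3)"
    proof -
      have "q\<^sup>2 \<le> 1/4" using power_mono[OF q2 pq(2), of 2] by (simp add: power2_eq_square)
      then show ?thesis using q2 pq by (intro mult_nonneg_nonneg add_nonneg_nonneg) auto
    qed
    ultimately show ?thesis by linarith
  qed
  also have "\<dots> \<le> exp (2 * q)"
    using exp_lower_Taylor_quadratic[of "2 * q"] pq by (simp add: power2_eq_square)
  finally have "?C * exp (2 * q) \<le> 1 * exp (2 * q)" by simp
  then show ?thesis by (rule mult_right_le_imp_le) simp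
qed

text \<open>\<open>F\<close> is the quotient of the two sides, expanded into exponentials of affine functions. At the corners
it equals $1 - 2pq$, $1 - (3 - e)pq$, and, at the two mixed corners, the expression of
\<open>corner_bound\<close> and its copy with $p$ and $q$ exchanged.\<close>

lemma two_sided_bound:
  fixes p q x y :: real
  assumes pq: "0 \<le> p" "0 \<le> q" "p + q = 1" and xy: "0 \<le> x" "x \<le> 1" "0 \<le> y" "y \<le> 1"
  shows "p ^ 3 * exp (- 2 * x) + q ^ 3 * exp (- 2 * y) + p * q * (p * exp (- x / 2) + q * exp (- y / 2))\<^sup>2
    \<le> exp (- 2 * (p * x + q * y))"
proof -
  define F where "F x y = p ^ 3 * exp (0 + (- 2 * q) * x + 2 * q * y) + q ^ 3 * exp (0 + 2 * p * x + (- 2 * p) * y)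
    + p * q * (p\<^sup>2 * exp (0 + (2 * p - 1) * x + 2 * q * y) + q\<^sup>2 * exp (0 + 2 * p * x + (2 * q - 1) * y)
      + 2 * p * q * exp (0 + (2 * p - 1/2) * x + (2 * q - 1/2) * y))" for x y
  have F: "(p ^ 3 * exp (- 2 * x) + q ^ 3 * exp (- 2 * y) + p * q * (p * exp (- x / 2) + q * exp (- y / 2))\<^sup>2)
     * exp (2 * (p * x + q * y)) = F x y"
  proof -
    define L where "L = 2 * (p * x + q * y)"
    have s: "(p * exp (- x / 2) + q * exp (- y / 2))\<^sup>2 = p\<^sup>2 * exp (- x) + q\<^sup>2 * exp (- y) + 2 * p * q * exp (- x/2 - y/2)"
      by (simp add: power2_sum power_mult_distrib exp_double[symmetric] mult_exp_exp)
    have z: "0 + (- 2 * q) * x + 2 * q * y = - 2 * x + L" "0 + 2 * p * x + (- 2 * p) * y = - 2 * y + L"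
      "0 + (2 * p - 1) * x + 2 * q * y = - x + L" "0 + 2 * p * x + (2 * q - 1) * y = - y + L"
      "0 + (2 * p - 1/2) * x + (2 * q - 1/2) * y = - x/2 - y/2 + L"
    proof -
      have p: "p = 1 - q" using pq by simp
      show "0 + (- 2 * q) * x + 2 * q * y = - 2 * x + L" "0 + 2 * p * x + (- 2 * p) * y = - 2 * y + L"
      "0 + (2 * p - 1) * x + 2 * q * y = - x + L" "0 + 2 * p * x + (2 * q - 1) * y = - y + L"
      "0 + (2 * p - 1/2) * x + (2 * q - 1/2) * y = - x/2 - y/2 + L"
        unfolding L_def p by (simp_all add: field_simps)
    qed
    show ?thesis unfolding F_def z s unfolding L_def[symmetric] exp_add by (simp add: algebra_simps)
  qed
  have "F x y \<le> p ^ 3 * ((1 - x) * (1 - y) * exp 0 + x * (1 - y) * exp (0 + (- 2 * q))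
      + (1 - x) * y * exp (0 + 2 * q) + x * y * exp (0 + (- 2 * q) + 2 * q))
    + q ^ 3 * ((1 - x) * (1 - y) * exp 0 + x * (1 - y) * exp (0 + 2 * p)
      + (1 - x) * y * exp (0 + (- 2 * p)) + x * y * exp (0 + 2 * p + (- 2 * p)))
    + p * q * (p\<^sup>2 * ((1 - x) * (1 - y) * exp 0 + x * (1 - y) * exp (0 + (2 * p - 1))
      + (1 - x) * y * exp (0 + 2 * q) + x * y * exp (0 + (2 * p - 1) + 2 * q)) 
      + q\<^sup>2 * ((1 - x) * (1 - y) * exp 0 + x * (1 - y) * exp (0 + 2 * p)
      + (1 - x) * y * exp (0 + (2 * q - 1)) + x * y * exp (0 + 2 * p + (2 * q - 1)))
      + 2 * p * q * ((1 - x) * (1 - y) * exp 0 + x * (1 - y) * exp (0 + (2 * p - 1/2))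
      + (1 - x) * y * exp (0 + (2 * q - 1/2)) + x * y * exp (0 + (2 * p - 1/2) + (2 * q - 1/2))))"
    unfolding F_def using pq by (intro add_mono mult_left_mono exp_le_bilinear xy) auto
  also have "\<dots> = (1 - x) * (1 - y) * F 0 0 + x * (1 - y) * F 1 0 + (1 - x) * y * F 0 1 + x * y * F 1 1"
    unfolding F_def by (simp only: mult_1_right mult_zero_right add_0_right) (simp only: algebra_simps)
  also have "\<dots> \<le> (1 - x) * (1 - y) * 1 + x * (1 - y) * 1 + (1 - x) * y * 1 + x * y * 1"
  proof (intro add_mono mult_left_mono)
    have p: "p = 1 - q" using pq by simp
    show "F 0 0 \<le> 1"
    proof -
      have "F 0 0 = 1 - 2 * (p * q)" unfolding F_def p by (simp add: algebra_simps power2_eq_square power3_eq_cube)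
      then show ?thesis using pq by simp
    qed
    show "F 1 1 \<le> 1"
    proof -
      have "F 1 1 = 1 - (3 - exp 1) * (p * q)" unfolding F_def p by (simp add: algebra_simps power2_eq_square power3_eq_cube)
      moreover have "0 \<le> (3 - exp 1) * (p * q)" using pq exp_le by (intro mult_nonneg_nonneg) auto
      ultimately show ?thesis by simp
    qed
    show "F 1 0 \<le> 1" using corner_bound[OF pq] by (simp add: F_def)
    show "F 0 1 \<le> 1" using corner_bound[OF pq(2,1)] pq(3) by (simp add: F_def algebra_simps)
  qed (use xy in auto)
  also have "\<dots> = exp (- 2 * (p * x + q * y)) * exp (2 * (p * x + q * y))" 
    by (simp add: exp_add[symmetric] algebra_simps)
  finally show ?thesis unfolding F[symmetric] by (rule mult_right_le_imp_le) simp
qed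

section \<open>Log-concave densities on the line\<close>

locale log_concave_density =
  fixes f :: "real \<Rightarrow> real"
  assumes nonneg: "0 \<le> f x"
    and integrable_density: "integrable lborel f"
    and integral_density: "(\<integral>x. f x \<partial>lborel) = 1"
    and open_support: "open {x. 0 < f x}"
    and ln_concave: "concave_on {x. 0 < f x} (\<lambda>x. ln (f x))"
begin

lemma support_convex: "0 < f x \<Longrightarrow> 0 < f y \<Longrightarrow> 0 \<le> t \<Longrightarrow> t \<le> 1 \<Longrightarrow> 0 < f ((1 - t) * x + t * y)"
  using concave_on_imp_convex[OF ln_concave] unfolding convex_alt by auto

lemma concave_le: "0 < f x \<Longrightarrow> 0 < f y \<Longrightarrow> 0 \<le> t \<Longrightarrow> t \<le> 1 \<Longrightarrow>
   (1 - t) * ln (f x) + t * ln (f y) \<le> ln (f ((1 - t) * x + t * y))"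
  using concave_onD[OF ln_concave, of t x y] by auto

text \<open>Beyond \<open>b\<close> a concave function lies below the secant through \<open>a\<close> and \<open>b\<close>.\<close>

lemma slope_le:
  assumes ab: "a < b" "b < x" and pos: "0 < f a" "0 < f x" 
  shows "0 < f b" "ln (f x) \<le> ln (f b) + (x - b) * ((ln (f b) - ln (f a)) / (b - a))"
proof -
  define t where "t = (b - a) / (x - a)"
  have t: "0 < t" "t < 1" using ab by (auto simp: t_def field_simps)
  have b: "(1 - t) * a + t * x = b" 
  proof -
    have "t * (x - a) = b - a" using ab by (simp add: t_def)
    then show ?thesis by (simp add: algebra_simps)
  qed
  show "0 < f b" using support_convex[OF pos, of t] t b by simp
  have "(1 - t) * ln (f a) + t * ln (f x) \<le> ln (f b)" using concave_le[OF pos, of t] t b by simp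
  then have "t * (ln (f x) - ln (f b)) \<le> (1 - t) * (ln (f b) - ln (f a))" by (simp add: algebra_simps)
  then have "ln (f x) - ln (f b) \<le> (1 - t) / t * (ln (f b) - ln (f a))" using t by (simp add: field_simps)
  also have "(1 - t) / t = (x - b) / (b - a)"
  proof -
    have "1 - t = (x - b) / (x - a)" using ab by (simp add: t_def diff_divide_eq_iff)
    then show ?thesis using ab by (simp add: t_def)
  qed
  finally show "ln (f x) \<le> ln (f b) + (x - b) * ((ln (f b) - ln (f a)) / (b - a))" by (simp add: algebra_simps)
qed

text \<open>Both inner points \<open>y\<close> and \<open>x + t\<close> are convex combinations of the outer ones, with complementary
weights.\<close>

lemma four_point:
  assumes "x \<le> y" "0 \<le> t"
  shows "f x * f (y + t) \<le> f y * f (x + t)"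
proof (cases "0 < f x \<and> 0 < f (y + t) \<and> x < y + t")
  case True
  define s where "s = (y - x) / (y + t - x)"
  have s: "0 \<le> s" "s \<le> 1" using True assms by (auto simp: s_def field_simps)
  have e: "(1 - s) * x + s * (y + t) = y" "(1 - (1 - s)) * x + (1 - s) * (y + t) = x + t"
    using True by (simp_all add: s_def divide_simps) (simp_all add: algebra_simps)
  have pos: "0 < f y" "0 < f (x + t)"
    using support_convex[of x "y + t" s] support_convex[of x "y + t" "1 - s"] s True unfolding e by auto
  have "(1 - s) * ln (f x) + s * ln (f (y + t)) \<le> ln (f y)"
    "(1 - (1 - s)) * ln (f x) + (1 - s) * ln (f (y + t)) \<le> ln (f (x + t))"
    using concave_le[of x "y + t" s] concave_le[of x "y + t" "1 - s"] s True unfolding e by auto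
  then have "ln (f x) + ln (f (y + t)) \<le> ln (f y) + ln (f (x + t))" by (simp add: algebra_simps)
  then have "ln (f x * f (y + t)) \<le> ln (f y * f (x + t))" using True pos by (simp add: ln_mult)
  then show ?thesis using True pos by (subst (asm) ln_le_cancel_iff) auto
next
  case False
  then have "f x * f (y + t) = 0 \<or> (x = y \<and> t = 0)"
    using nonneg[of x] nonneg[of "y + t"] assms by (auto simp: le_less)
  then show ?thesis using nonneg by auto
qed

lemma reflect: "log_concave_density (\<lambda>x. f (- x))"
proof
  have "open (uminus -` {x. 0 < f x})" by (intro open_vimage open_support continuous_intros)
  then show "open {x. 0 < f (- x)}" by (simp add: vimage_def)
  show "integrable lborel (\<lambda>x. f (- x))"
    using lborel_integrable_real_affine[OF integrable_density, of "-1" 0] by simp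
  show "(\<integral>x. f (- x) \<partial>lborel) = 1"
    using lborel_integral_real_affine[of "-1" f 0] integral_density by simp
  show "concave_on {x. 0 < f (- x)} (\<lambda>x. ln (f (- x)))"
    unfolding concave_on_iff
  proof (intro conjI ballI allI impI)
    show "convex {x. 0 < f (- x)}"
      unfolding convex_alt
    proof (intro ballI allI impI)
      fix x y u :: real assume "x \<in> {x. 0 < f (- x)}" "y \<in> {x. 0 < f (- x)}" "0 \<le> u \<and> u \<le> 1"
      then show "(1 - u) *\<^sub>R x + u *\<^sub>R y \<in> {x. 0 < f (- x)}"
        using support_convex[of "- x" "- y" u] by (simp add: algebra_simps)
    qed
  next
    fix x y u v assume a: "x \<in> {x. 0 < f (- x)}" "y \<in> {x. 0 < f (- x)}" "0 \<le> u" "0 \<le> v" "u + v = (1::real)"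
    have "u = 1 - v" using a by simp
    show "u * ln (f (- x)) + v * ln (f (- y)) \<le> ln (f (- (u *\<^sub>R x + v *\<^sub>R y)))"
      using concave_le[of "- x" "- y" v] a unfolding \<open>u = 1 - v\<close> by (simp add: algebra_simps)
  qed
qed (rule nonneg)

lemma f_continuous: "continuous_on {x. 0 < f x} f"
proof -
  have "continuous_on {x. 0 < f x} (\<lambda>x. - ln (f x))"
    using ln_concave unfolding concave_on_def by (rule convex_on_continuous[OF open_support])
  from continuous_on_exp[OF continuous_on_minus[OF this]]
  show ?thesis by (rule continuous_on_eq) simp
qed

lemma support_points: "\<exists>a b. a < b \<and> 0 < f a \<and> 0 < f b"
proof -
  obtain a where a: "0 < f a"
  proof (rule ccontr)
    assume "\<not> thesis"
    then have "f x = 0" for x using that nonneg[of x] by (auto simp: le_less)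
    then show False using integral_density by simp
  qed
  then obtain e where "e > 0" "ball a e \<subseteq> {x. 0 < f x}" using open_support by (auto simp: open_contains_ball)
  then show ?thesis using a by (intro exI[of _ a] exI[of _ "a + e/2"]) (auto simp: dist_real_def subset_iff)
qed

text \<open>A density cannot stay above a positive constant on an unbounded interval.\<close>

lemma exists_smaller: assumes "0 < f a" shows "\<exists>z>a. f z < f a"
proof (rule ccontr)
  assume "\<not> ?thesis"
  then have ge: "f a \<le> f z" if "a < z" for z using that not_less by blast
  define L where "L = 2 / f a"
  have L: "0 < L" using assms by (simp add: L_def)
  have "(\<integral>x. f a * indicator {a<..a + L} x \<partial>lborel) \<le> (\<integral>x. f x \<partial>lborel)"
  proof (rule integral_mono[OF _ integrable_density])
    show "integrable lborel (\<lambda>x. f a * indicator {a<..a + L} x)" using L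
      by (intro integrable_mult_right integrable_real_indicator) (auto simp: emeasure_lborel_Ioc)
    show "f a * indicator {a<..a + L} x \<le> f x" for x using ge[of x] nonneg[of x] by (auto simp: indicator_def)
  qed
  then show False using L assms integral_density by (simp add: L_def)
qed

text \<open>Secants of \<open>ln f\<close> bound the density twice: the secant over \<open>a\<close> and \<open>b\<close> on a bounded interval,
and the secant over \<open>b\<close> and \<open>z\<close>, which has negative slope, beyond it.\<close>

lemma right_exponential_bound:
  assumes ab: "a < b" "0 < f a" "0 < f b"
  shows "\<exists>A \<kappa>. 0 < \<kappa> \<and> 0 \<le> A \<and> (\<forall>x\<ge>b. f x \<le> A * exp (- \<kappa> * \<bar>x\<bar>))"
proof -
  obtain z where z: "b < z" "f z < f b" using exists_smaller[OF ab(3)] by blast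
  define k where "k = \<bar>(ln (f b) - ln (f a)) / (b - a)\<bar>"
  define M where "M = f b * exp (k * (z - b))"
  have M0: "0 \<le> M" using ab by (simp add: M_def)
  have M: "f x \<le> M" if "b \<le> x" "x \<le> z" for x
  proof (cases "b < x \<and> 0 < f x")
    case True
    have "ln (f x) \<le> ln (f b) + (x - b) * ((ln (f b) - ln (f a)) / (b - a))" using slope_le[of a b x] ab True by auto
    also have "\<dots> \<le> ln (f b) + (z - b) * k" using that True unfolding k_def
      by (intro add_left_mono order.trans[OF mult_left_mono[OF abs_ge_self] mult_right_mono]) auto
    also have "\<dots> = ln M" using ab by (simp add: M_def ln_mult)
    finally show ?thesis using True ab by (subst (asm) ln_le_cancel_iff) (auto simp: M_def)
  next
    case False
    then have "f x \<le> f b" using that nonneg[of x] ab by (auto simp: le_less)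
    also have "\<dots> \<le> M" using ab z by (simp add: M_def k_def)
    finally show ?thesis .
  qed
  have "\<exists>\<kappa>>0. \<forall>x>z. f x \<le> M * exp (- \<kappa> * (x - z))"
  proof (cases "0 < f z")
    case True
    define \<kappa> where "\<kappa> = (ln (f b) - ln (f z)) / (z - b)"
    have "ln (f z) < ln (f b)" using z ab True by simp
    then have k: "0 < \<kappa>" using z by (simp add: \<kappa>_def)
    have "f x \<le> M * exp (- \<kappa> * (x - z))" if "z < x" for x
    proof (cases "0 < f x")
      case fx: True
      have "ln (f x) \<le> ln (f z) + (x - z) * ((ln (f z) - ln (f b)) / (z - b))"
        using slope_le[of b z x] z ab that fx by auto
      also have "(ln (f z) - ln (f b)) / (z - b) = - \<kappa>" by (simp add: \<kappa>_def minus_divide_left)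
      also have "ln (f z) + (x - z) * - \<kappa> = ln (f z * exp (- \<kappa> * (x - z)))" using True by (simp add: ln_mult)
      finally have "f x \<le> f z * exp (- \<kappa> * (x - z))" using True fx by (subst (asm) ln_le_cancel_iff) auto
      also have "\<dots> \<le> M * exp (- \<kappa> * (x - z))" using M[of z] z by (intro mult_right_mono) auto
      finally show ?thesis .
    next
      case False
      moreover have "0 \<le> M * exp (- \<kappa> * (x - z))" using M0 by simp
      ultimately show ?thesis by linarith
    qed
    then show ?thesis using k by blast
  next
    case False
    have "f x \<le> M * exp (- 1 * (x - z))" if "z < x" for x
    proof -
      have "\<not> 0 < f x" using slope_le(1)[of b z x] z ab that False by auto
      moreover have "0 \<le> M * exp (- 1 * (x - z))" using M0 by simp
      ultimately show ?thesis by linarith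
    qed
    then show ?thesis by (intro exI[of _ 1]) auto
  qed
  then obtain \<kappa> where k: "0 < \<kappa>" "\<And>x. z < x \<Longrightarrow> f x \<le> M * exp (- \<kappa> * (x - z))" by blast
  define A where "A = M * exp (\<kappa> * (z + 2 * \<bar>b\<bar>))"
  have "f x \<le> A * exp (- \<kappa> * \<bar>x\<bar>)" if "b \<le> x" for x
  proof -
    have "f x \<le> M * exp (- \<kappa> * (x - z))"
    proof (cases "x \<le> z")
      case True
      have "M * 1 \<le> M * exp (- \<kappa> * (x - z))" using True k(1) M0 
        by (intro mult_left_mono) (auto simp: mult_nonneg_nonpos)
      then show ?thesis using M[OF that True] by simp
    qed (use k(2)[of x] in simp)
    also have "\<dots> \<le> M * exp (\<kappa> * (z + 2 * \<bar>b\<bar>) + - \<kappa> * \<bar>x\<bar>)"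
    proof (intro mult_left_mono M0)
      have "\<kappa> * \<bar>x\<bar> \<le> \<kappa> * (x + 2 * \<bar>b\<bar>)" using that k(1) by (intro mult_left_mono) auto
      then show "exp (- \<kappa> * (x - z)) \<le> exp (\<kappa> * (z + 2 * \<bar>b\<bar>) + - \<kappa> * \<bar>x\<bar>)" by (simp add: algebra_simps)
    qed
    finally show ?thesis unfolding A_def by (simp only: exp_add mult.assoc)
  qed
  then show ?thesis using k(1) M0 by (intro exI[of _ A] exI[of _ \<kappa>]) (auto simp: A_def)
qed

lemma exponential_bound: "\<exists>A \<kappa>. 0 < \<kappa> \<and> 0 \<le> A \<and> (\<forall>x. f x \<le> A * exp (- \<kappa> * \<bar>x\<bar>))"
proof -
  obtain a b where ab: "a < b" "0 < f a" "0 < f b" using support_points by blast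
  \<comment> \<open>Both one-sided bounds start from the same point \<open>m\<close> in the support, so they cover the line.\<close>
  define m where "m = (a + b) / 2"
  have m: "a < m" "m < b" using ab by (auto simp: m_def)
  have fm: "0 < f m" using slope_le(1)[OF m] ab by simp
  obtain A1 k1 where 1: "0 < k1" "0 \<le> A1" "\<And>x. m \<le> x \<Longrightarrow> f x \<le> A1 * exp (- k1 * \<bar>x\<bar>)"
    using right_exponential_bound[OF m(1) ab(2) fm] by blast
  have "\<exists>A \<kappa>. 0 < \<kappa> \<and> 0 \<le> A \<and> (\<forall>x\<ge>- m. f (- x) \<le> A * exp (- \<kappa> * \<bar>x\<bar>))"
    by (rule log_concave_density.right_exponential_bound[OF reflect, of "- b"]) (use ab m fm in auto)
  then obtain A2 k2 where 2: "0 < k2" "0 \<le> A2" "\<And>x. - m \<le> x \<Longrightarrow> f (- x) \<le> A2 * exp (- k2 * \<bar>x\<bar>)" by blast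
  define A where "A = max A1 A2"
  define k where "k = min k1 k2"
  have le: "B * exp (- l * \<bar>x\<bar>) \<le> A * exp (- k * \<bar>x\<bar>)" if "0 \<le> B" "B \<le> A" "k \<le> l" for B l x
    using that by (intro mult_mono) (auto intro: mult_right_mono)
  have "f x \<le> A * exp (- k * \<bar>x\<bar>)" for x
  proof (cases "m \<le> x")
    case True
    show ?thesis using order.trans[OF 1(3)[OF True] le[of A1 k1]] 1(2) by (simp add: A_def k_def)
  next
    case False
    then have "f x \<le> A2 * exp (- k2 * \<bar>x\<bar>)" using 2(3)[of "- x"] by simp
    then show ?thesis using le[of A2 k2 x] 2(2) by (simp add: A_def k_def)
  qed
  moreover have "0 < k" "0 \<le> A" using 1 2 by (auto simp: A_def k_def)
  ultimately show ?thesis by blast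
qed

end

lemma integrable_exp_abs: assumes k: "0 < k" shows "integrable lborel (\<lambda>x::real. exp (- k * \<bar>x\<bar>))"
proof -
  have "integrable lborel (exponential_density k)"
  proof (rule integrableI_nonneg)
    have "(\<integral>\<^sup>+x. ennreal (exponential_density k x) \<partial>lborel) = 1"
      using prob_space.emeasure_space_1[OF prob_space_exponential_density[OF k]] by (simp add: emeasure_density)
    then show "(\<integral>\<^sup>+x. ennreal (exponential_density k x) \<partial>lborel) < \<infinity>" by simp
  qed (use k in \<open>auto simp: exponential_density_nonneg\<close>)
  then have 1: "integrable lborel (\<lambda>x. exponential_density k x + exponential_density k (0 + (-1) * x))"
    using lborel_integrable_real_affine[of "exponential_density k" "-1" 0]
    by (intro Bochner_Integration.integrable_add) auto
  have "integrable lborel (\<lambda>x. (exponential_density k x + exponential_density k (0 + (-1) * x)) / k)"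
    using 1 by simp
  then show ?thesis
    by (rule Bochner_Integration.integrable_bound)
       (use k in \<open>auto simp: exponential_density_def field_simps abs_if intro!: AE_I2\<close>)
qed

lemma abs_mult_exp_le:
  fixes x k :: real assumes "0 < k"
  shows "\<bar>x\<bar> * exp (- k * \<bar>x\<bar>) \<le> (2 / k) * exp (- (k / 2) * \<bar>x\<bar>)"
proof -
  have "(k / 2) * \<bar>x\<bar> \<le> exp ((k / 2) * \<bar>x\<bar>)" using exp_ge_add_one_self[of "(k/2) * \<bar>x\<bar>"] by linarith
  then have "\<bar>x\<bar> \<le> (2 / k) * exp ((k / 2) * \<bar>x\<bar>)" using assms by (simp add: field_simps)
  then have "\<bar>x\<bar> * exp (- k * \<bar>x\<bar>) \<le> (2 / k) * exp ((k / 2) * \<bar>x\<bar>) * exp (- k * \<bar>x\<bar>)" by (rule mult_right_mono) simp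
  also have "\<dots> = (2 / k) * exp (- (k / 2) * \<bar>x\<bar>)" by (simp add: exp_add[symmetric] algebra_simps)
  finally show ?thesis .
qed

text \<open>The square root dominates for small \<open>t\<close> and inherits exponential decay, so \<open>f ln f\<close> is
integrable.\<close>

lemma abs_x_ln_x_le:
  assumes "0 \<le> (t::real)" shows "\<bar>t * ln t\<bar> \<le> 2 * sqrt t + t\<^sup>2"
proof -
  consider "t = 0" | "0 < t" "t < 1" | "1 \<le> t" using assms by linarith
  then show ?thesis
  proof cases
    case 2
    have "ln (1 / sqrt t) \<le> 1 / sqrt t - 1" using 2 by (intro ln_le_minus_one) auto
    then have l: "- ln t \<le> 2 / sqrt t" using 2 by (simp add: ln_div ln_sqrt)
    have "\<bar>t * ln t\<bar> = t * (- ln t)" using 2 by (simp add: abs_mult)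
    also have "\<dots> \<le> t * (2 / sqrt t)" using l 2 by (intro mult_left_mono) auto
    also have "\<dots> = 2 * (t / sqrt t)" by simp
    also have "\<dots> = 2 * sqrt t" using 2 by (simp only: real_div_sqrt)
    finally show ?thesis by (simp add: add_increasing2)
  next
    case 3
    have "\<bar>t * ln t\<bar> = t * ln t" using 3 by simp
    also have "\<dots> \<le> t * t" using 3 ln_le_minus_one[of t] by (intro mult_left_mono) auto
    finally show ?thesis using 3 by (simp add: power2_eq_square add_increasing)
  qed simp
qed

context log_concave_density begin

lemma density_measurable[measurable]: "f \<in> borel_measurable borel"
  using borel_measurable_integrable[OF integrable_density] by simp

lemma integrable_if_exponential_bound:
  fixes g :: "real \<Rightarrow> real"
  assumes [measurable]: "g \<in> borel_measurable borel" and k: "0 < k" and le: "\<And>x. \<bar>g x\<bar> \<le> B * exp (- k * \<bar>x\<bar>)"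
  shows "integrable lborel g"
proof (rule Bochner_Integration.integrable_bound)
  show "integrable lborel (\<lambda>x. B * exp (- k * \<bar>x\<bar>))" by (intro integrable_mult_right integrable_exp_abs[OF k])
  show "AE x in lborel. norm (g x) \<le> norm (B * exp (- k * \<bar>x\<bar>))"
  proof (rule AE_I2)
    fix x show "norm (g x) \<le> norm (B * exp (- k * \<bar>x\<bar>))"
      using le[of x] abs_ge_self[of "B * exp (- k * \<bar>x\<bar>)"] by simp
  qed
qed simp

lemma integrable_moments:
  "integrable lborel (\<lambda>x. x * f x)" "integrable lborel (\<lambda>x. x\<^sup>2 * f x)" "integrable lborel (\<lambda>x. f x * ln (f x))"
proof -
  obtain A k where A: "0 < k" "0 \<le> A" "\<And>x. f x \<le> A * exp (- k * \<bar>x\<bar>)" using exponential_bound by blast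
  have 1: "\<bar>x * f x\<bar> \<le> (A * (2 / k)) * exp (- (k / 2) * \<bar>x\<bar>)" for x
  proof -
    have "\<bar>x * f x\<bar> \<le> \<bar>x\<bar> * (A * exp (- k * \<bar>x\<bar>))" 
      unfolding abs_mult using A(3)[of x] nonneg[of x] by (intro mult_left_mono) auto
    also have "\<dots> \<le> A * ((2 / k) * exp (- (k / 2) * \<bar>x\<bar>))"
      using mult_left_mono[OF abs_mult_exp_le[OF A(1), of x] A(2)] by (simp add: mult_ac)
    finally show ?thesis by simp
  qed
  show "integrable lborel (\<lambda>x. x * f x)"
    by (rule integrable_if_exponential_bound[OF _ _ 1]) (use A in auto)
  have 2: "\<bar>x\<^sup>2 * f x\<bar> \<le> (A * (2 / k) * (4 / k)) * exp (- (k / 4) * \<bar>x\<bar>)" for x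
  proof -
    have "\<bar>x\<^sup>2 * f x\<bar> = \<bar>x\<bar> * \<bar>x * f x\<bar>" by (simp add: abs_mult power2_eq_square)
    also have "\<dots> \<le> \<bar>x\<bar> * ((A * (2 / k)) * exp (- (k / 2) * \<bar>x\<bar>))" by (intro mult_left_mono 1) auto
    also have "\<dots> \<le> (A * (2 / k)) * ((4 / k) * exp (- (k / 4) * \<bar>x\<bar>))"
      using mult_left_mono[OF abs_mult_exp_le[of "k/2" x], of "A * (2 / k)"] A by (simp add: mult_ac)
    finally show ?thesis by simp
  qed
  show "integrable lborel (\<lambda>x. x\<^sup>2 * f x)"
    by (rule integrable_if_exponential_bound[OF _ _ 2]) (use A in auto)
  have 3: "\<bar>f x * ln (f x)\<bar> \<le> (2 * sqrt A + A\<^sup>2) * exp (- (k / 2) * \<bar>x\<bar>)" for x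
  proof -
    have e: "exp (- k * \<bar>x\<bar>) = (exp (- (k / 2) * \<bar>x\<bar>))\<^sup>2" by (simp add: power2_eq_square exp_add[symmetric])
    have le1: "exp (- (k / 2) * \<bar>x\<bar>) \<le> 1" using A(1) by simp
    have "sqrt (f x) \<le> sqrt (A * exp (- k * \<bar>x\<bar>))" using A(3) by simp
    also have "\<dots> = sqrt A * exp (- (k / 2) * \<bar>x\<bar>)" unfolding e by (simp add: real_sqrt_mult)
    finally have s: "sqrt (f x) \<le> sqrt A * exp (- (k / 2) * \<bar>x\<bar>)" .
    have "(f x)\<^sup>2 \<le> (A * exp (- k * \<bar>x\<bar>))\<^sup>2" using A(3)[of x] nonneg[of x] by (intro power_mono) auto
    also have "\<dots> = A\<^sup>2 * ((exp (- (k / 2) * \<bar>x\<bar>)) ^ 4)" unfolding e by (simp add: power_mult_distrib)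
    also have "\<dots> \<le> A\<^sup>2 * (exp (- (k / 2) * \<bar>x\<bar>)) ^ 1"
      using le1 by (intro mult_left_mono power_decreasing) auto
    finally have "(f x)\<^sup>2 \<le> A\<^sup>2 * exp (- (k / 2) * \<bar>x\<bar>)" by simp
    then show ?thesis using abs_x_ln_x_le[OF nonneg[of x]] s by (simp add: distrib_right)
  qed
  show "integrable lborel (\<lambda>x. f x * ln (f x))"
    by (rule integrable_if_exponential_bound[OF _ _ 3]) (use A in auto)
qed

text \<open>The mode as the limit of a maximising sequence, which stays bounded because the density decays.
The density need not be continuous at the mode, so the sequence itself is part of the result.\<close>

lemma mode_exists:
  obtains c H u where "0 < H" "\<And>x. f x \<le> H" "u \<longlonglongrightarrow> c" "(\<lambda>n. f (u n)) \<longlonglongrightarrow> H"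
proof -
  obtain A k where A: "0 < k" "0 \<le> A" "\<And>x. f x \<le> A * exp (- k * \<bar>x\<bar>)" using exponential_bound by blast
  have "f x \<le> A" for x
    using A(3)[of x] mult_left_mono[of "exp (- k * \<bar>x\<bar>)" 1 A] A(1,2) by simp
  then have bdd: "bdd_above (range f)" by (auto simp: bdd_above_def)
  define H where "H = (SUP x. f x)"
  have le: "f x \<le> H" for x unfolding H_def by (rule cSUP_upper[OF _ bdd]) simp
  obtain a where "0 < f a" using support_points by blast
  then have H: "0 < H" using le[of a] by simp
  have "\<exists>x. H * (1 - 1 / (real n + 2)) < f x" for n
  proof -
    have "H * (1 - 1 / (real n + 2)) < H" using H by (simp add: field_simps)
    then show ?thesis using less_cSUP_iff[of UNIV f "H * (1 - 1 / (real n + 2))"] bdd by (simp add: H_def)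
  qed
  then obtain v where v: "\<And>n. H * (1 - 1 / (real n + 2)) < f (v n)" by metis
  have "\<bar>v n\<bar> \<le> 2 * A / (H * k)" for n
  proof -
    have "1 / 2 \<le> 1 - 1 / (real n + 2)" by (simp add: field_simps)
    then have "H * (1 / 2) \<le> H * (1 - 1 / (real n + 2))" using H by (intro mult_left_mono) auto
    also have "\<dots> \<le> A * exp (- k * \<bar>v n\<bar>)" using v[of n] A(3)[of "v n"] by simp
    finally have "H * (1/2) * exp (k * \<bar>v n\<bar>) \<le> A * exp (- k * \<bar>v n\<bar>) * exp (k * \<bar>v n\<bar>)" by (rule mult_right_mono) simp
    then have 1: "H * (1/2) * exp (k * \<bar>v n\<bar>) \<le> A" by (simp add: mult.assoc exp_add[symmetric])
    have "k * \<bar>v n\<bar> \<le> exp (k * \<bar>v n\<bar>)" using exp_ge_add_one_self[of "k * \<bar>v n\<bar>"] by linarith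
    then have "H * (1/2) * (k * \<bar>v n\<bar>) \<le> H * (1/2) * exp (k * \<bar>v n\<bar>)" using H by (intro mult_left_mono) auto
    then have "H * (1/2) * (k * \<bar>v n\<bar>) \<le> A" using 1 by linarith
    then show ?thesis using H A(1) by (simp add: pos_le_divide_eq mult_ac)
  qed
  then have "bounded (range v)" unfolding bounded_iff by auto
  then obtain c r where r: "strict_mono r" "(v \<circ> r) \<longlonglongrightarrow> c"
    using bounded_imp_convergent_subsequence by blast
  have "(\<lambda>n. f (v n)) \<longlonglongrightarrow> H"
  proof (rule tendsto_sandwich[OF _ _ _ tendsto_const])
    show "(\<lambda>n. H * (1 - 1 / (real n + 2))) \<longlonglongrightarrow> H" by real_asymp
  qed (use v le in \<open>auto intro!: always_eventually less_imp_le\<close>)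
  from LIMSEQ_subseq_LIMSEQ[OF this r(1)] show ?thesis
    using that[OF H le r(2)] by (simp add: o_def)
qed

lemma tail_shift: "tail f x = (\<integral>t. indicator {0..} t * f (x + t) \<partial>lborel)"
proof -
  have "tail f x = (\<integral>y. indicator {x..} y * f y \<partial>lborel)" by (simp add: tail_def set_lebesgue_integral_def)
  also have "\<dots> = (\<integral>t. indicator {x..} (x + t) * f (x + t) \<partial>lborel)"
    using lborel_integral_real_affine[of 1 "\<lambda>y. indicator {x..} y * f y" x] by simp
  also have "\<dots> = (\<integral>t. indicator {0..} t * f (x + t) \<partial>lborel)"
    by (intro Bochner_Integration.integral_cong) (auto simp: indicator_def)
  finally show ?thesis .
qed

text \<open>The inequality \<open>four_point\<close>, integrated over \<open>t \<ge> 0\<close>.\<close>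

lemma hazard_rate_mono: assumes "x \<le> y" shows "f x * tail f y \<le> f y * tail f x"
proof -
  have i: "integrable lborel (\<lambda>t. indicator {0..} t * f (z + t))" for z
    using integrable_mult_indicator[of "{0..}" lborel "\<lambda>t. f (z + 1 * t)"]
      lborel_integrable_real_affine[OF integrable_density, of 1 z] by simp
  have "(\<integral>t. f x * (indicator {0..} t * f (y + t)) \<partial>lborel) \<le> (\<integral>t. f y * (indicator {0..} t * f (x + t)) \<partial>lborel)"
    by (rule integral_mono) (use i four_point[OF assms] in \<open>auto simp: indicator_def intro!: integrable_mult_right\<close>)
  then show ?thesis by (simp add: tail_shift)
qed

text \<open>The mode enters through the maximising sequence only: monotonicity to the right of \<open>c\<close> and the bound
for the hazard rate hold with \<open>u n\<close> in place of \<open>c\<close> for large \<open>n\<close>, and pass to the limit.\<close>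

lemma half_line:
  assumes H: "\<And>x. f x \<le> H" and u: "u \<longlonglongrightarrow> c" "(\<lambda>n. f (u n)) \<longlonglongrightarrow> H"
  shows "log_concave_half_line f c H"
proof
  show "f y \<le> f x" if xy: "c < x" "x \<le> y" for x y
  proof (rule ccontr)
    assume "\<not> f y \<le> f x"
    then have l: "f x < f y" by simp
    then have lt: "x < y" using xy by (cases "x = y") auto
    have "\<forall>\<^sub>F n in sequentially. u n < x \<and> f x < f (u n)"
      using order_tendstoD(2)[OF u(1) xy(1)] order_tendstoD(1)[OF u(2), of "f x"] l H[of y] by (auto intro: eventually_conj)
    then obtain n where n: "u n < x" "f x < f (u n)" by (auto simp: eventually_sequentially)
    define t where "t = (x - u n) / (y - u n)"
    have t: "0 < t" "t < 1" using n lt by (auto simp: t_def)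
    have e: "(1 - t) * u n + t * y = x"
    proof -
      have "t * (y - u n) = x - u n" using n lt by (simp add: t_def)
      then show ?thesis by (simp add: algebra_simps)
    qed
    have pos: "0 < f (u n)" "0 < f y" using nonneg[of x] n l by auto
    have px: "0 < f x" using support_convex[OF pos, of t] t e by simp
    have "(1 - t) * ln (f (u n)) + t * ln (f y) \<le> ln (f x)" using concave_le[OF pos, of t] t e by simp
    moreover have "(1 - t) * ln (f x) < (1 - t) * ln (f (u n))" "t * ln (f x) < t * ln (f y)" using t px n l pos by auto
    ultimately show False by (simp add: algebra_simps)
  qed
  show "H * tail f x \<le> f x * tail f c" if "c < x" for x
  proof (rule tendsto_le[OF trivial_limit_sequentially])
    show "(\<lambda>n. f (u n) * tail f x) \<longlonglongrightarrow> H * tail f x" by (intro tendsto_intros u)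
    show "(\<lambda>n. f x * tail f (u n)) \<longlonglongrightarrow> f x * tail f c"
      by (intro tendsto_intros isCont_tendsto_compose[OF tail_continuous] integrable_density u)
    show "\<forall>\<^sub>F n in sequentially. f (u n) * tail f x \<le> f x * tail f (u n)"
      using order_tendstoD(2)[OF u(1) that] by eventually_elim (rule hazard_rate_mono, simp)
  qed
qed (use nonneg H hazard_rate_mono in \<open>auto intro: integrable_moments integrable_density open_support f_continuous\<close>)

lemma tail_reflect:
  assumes g: "integrable lborel g"
  shows "tail g c + tail (\<lambda>y. g (- y)) (- c) = (\<integral>y. g y \<partial>lborel)"
proof -
  have "tail (\<lambda>y. g (- y)) (- c) = (\<integral>y. indicator {- c..} y * g (- y) \<partial>lborel)"
    by (simp add: tail_def set_lebesgue_integral_def)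
  also have "\<dots> = (\<integral>y. indicator {- c..} (- y) * g y \<partial>lborel)"
    using lborel_integral_real_affine[of "-1" "\<lambda>y. indicator {- c..} y * g (- y)" 0] by simp
  also have "\<dots> = (\<integral>y. indicator {..c} y * g y \<partial>lborel)"
    by (intro Bochner_Integration.integral_cong) (auto simp: indicator_def)
  also have "\<dots> = (LINT y:{..<c}|lborel. g y)"
    unfolding set_lebesgue_integral_def using AE_lborel_singleton[of c] borel_measurable_integrable[OF g]
    by (intro integral_cong_AE) (auto simp: indicator_def elim!: eventually_mono)
  finally have "tail g c + tail (\<lambda>y. g (- y)) (- c) = (LINT y:{c..} \<union> {..<c}|lborel. g y)"
    unfolding tail_def by (subst set_integral_Un) (auto intro: integrable_imp_set_integrable[OF g])
  also have "{c..} \<union> {..<c} = UNIV" by auto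
  finally show ?thesis by (simp add: set_lebesgue_integral_def)
qed

end

section \<open>Entropy and variance of log-concave random variables\<close>

context log_concave_density begin

text \<open>The left half-line is the right half-line of the reflected density. The central moments about the
mean are rewritten as moments about the mode, where the half-line bounds live.\<close>

theorem variance_entropy:
  defines "v \<equiv> (\<integral>x. x\<^sup>2 * f x \<partial>lborel) - (\<integral>x. x * f x \<partial>lborel)\<^sup>2"
  shows "0 < v" "1 / 2 * ln v + 1 \<le> - (\<integral>x. f x * ln (f x) \<partial>lborel)"
proof -
  obtain H u c where m: "0 < H" "\<And>x. f x \<le> H" "u \<longlonglongrightarrow> c" "(\<lambda>n. f (u n)) \<longlonglongrightarrow> H"
    by (rule mode_exists) (rule that)
  interpret l: log_concave_density "\<lambda>x. f (- x)" by (rule reflect)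
  interpret R: log_concave_half_line f c H by (rule half_line[OF m(2-4)])
  interpret L: log_concave_half_line "\<lambda>x. f (- x)" "- c" H
    by (rule l.half_line[where u="\<lambda>n. - u n"]) (use m in \<open>auto intro: tendsto_intros\<close>)
  obtain x m1 s1 where R: "0 \<le> x" "x \<le> 1" "0 \<le> m1" "0 \<le> s1" "0 < R.S c \<longrightarrow> 0 < s1"
    "R.N c = R.S c * (1 - ln H - x)" "R.S1 c = R.S c * m1" "2 * R.S2 c = R.S c * (s1 + m1\<^sup>2)"
    "H * m1 \<le> R.S c * exp (- x / 2)" "H\<^sup>2 * s1 \<le> (R.S c)\<^sup>2 * exp (- 2 * x)"
    by (rule R.half_line_bounds) (rule that)
  obtain y m2 s2 where L: "0 \<le> y" "y \<le> 1" "0 \<le> m2" "0 \<le> s2" "0 < L.S (- c) \<longrightarrow> 0 < s2"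
    "L.N (- c) = L.S (- c) * (1 - ln H - y)" "L.S1 (- c) = L.S (- c) * m2" "2 * L.S2 (- c) = L.S (- c) * (s2 + m2\<^sup>2)"
    "H * m2 \<le> L.S (- c) * exp (- y / 2)" "H\<^sup>2 * s2 \<le> (L.S (- c))\<^sup>2 * exp (- 2 * y)"
    by (rule L.half_line_bounds) (rule that)
  define p where "p = R.S c"
  define q where "q = L.S (- c)"
  define M1 where "M1 = (\<integral>x. x * f x \<partial>lborel)"
  define M2 where "M2 = (\<integral>x. x\<^sup>2 * f x \<partial>lborel)"
  define h where "h = - (\<integral>x. f x * ln (f x) \<partial>lborel)"
  have pq: "0 \<le> p" "0 \<le> q" "p + q = 1"
    using R.S_nonneg L.S_nonneg tail_reflect[OF integrable_density, of c] integral_density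
    by (simp_all add: p_def q_def R.S_def L.S_def)
  have h: "h = R.N c + L.N (- c)"
    using tail_reflect[OF integrable_moments(3), of c] by (simp add: h_def R.N_def L.N_def)
  have T1: "M1 = tail (\<lambda>y. y * f y) c - tail (\<lambda>y. y * f (- y)) (- c)"
    using tail_reflect[OF integrable_moments(1), of c] 
      tail_lincomb[OF l.integrable_moments(1) l.integrable_moments(1), of "-1" 0 "- c"] by (simp add: M1_def)
  have T2: "M2 = tail (\<lambda>y. y\<^sup>2 * f y) c + tail (\<lambda>y. y\<^sup>2 * f (- y)) (- c)"
    using tail_reflect[OF integrable_moments(2), of c] by (simp add: M2_def)
  have S1: "M1 - c = p * m1 - q * m2"
  proof -
    have "M1 - c * (p + q) = R.S1 c - L.S1 (- c)"
      unfolding R.S1_def L.S1_def T1 p_def[symmetric] q_def[symmetric] by (simp add: algebra_simps)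
    then show ?thesis unfolding pq(3) R(7) L(7) by (simp add: p_def q_def)
  qed
  have S2: "M2 - 2 * c * M1 + c\<^sup>2 = p * (s1 + m1\<^sup>2) + q * (s2 + m2\<^sup>2)"
  proof -
    have "M2 - 2 * c * M1 + c\<^sup>2 * (p + q) = 2 * R.S2 c + 2 * L.S2 (- c)"
      unfolding R.S2_def L.S2_def T1 T2 p_def[symmetric] q_def[symmetric] by (simp add: field_simps)
    then show ?thesis unfolding pq(3) R(8) L(8) by (simp add: p_def q_def)
  qed
  have v: "v = p * s1 + q * s2 + p * q * (m1 + m2)\<^sup>2"
  proof -
    have "v = (M2 - 2 * c * M1 + c\<^sup>2) - (M1 - c)\<^sup>2"
      by (simp add: v_def M1_def M2_def power2_eq_square algebra_simps)
    also have "\<dots> = p * (s1 + m1\<^sup>2) + q * (s2 + m2\<^sup>2) - (p * m1 - q * m2)\<^sup>2" unfolding S1 S2 ..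
    also have "\<dots> = p * s1 + q * s2 + p * q * (m1 + m2)\<^sup>2"
    proof -
      have p: "p = 1 - q" using pq by simp
      show ?thesis unfolding p by (simp add: power2_eq_square algebra_simps)
    qed
    finally show ?thesis .
  qed
  show v0: "0 < v"
  proof (cases "0 < p")
    case True
    then have "0 < p * s1" using R(5) by (simp add: p_def)
    moreover have "0 \<le> q * s2" "0 \<le> p * q * (m1 + m2)\<^sup>2" using pq L(4) by auto
    ultimately show ?thesis unfolding v by linarith
  next
    case False
    then have "p = 0" "q = 1" using pq by auto
    then show ?thesis using L(5) unfolding v by (simp add: q_def)
  qed
  have "H\<^sup>2 * v = p * (H\<^sup>2 * s1) + q * (H\<^sup>2 * s2) + p * q * (H * m1 + H * m2)\<^sup>2"
    unfolding v by (simp add: power2_eq_square algebra_simps)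
  also have "\<dots> \<le> p * (p\<^sup>2 * exp (- 2 * x)) + q * (q\<^sup>2 * exp (- 2 * y)) + p * q * (p * exp (- x / 2) + q * exp (- y / 2))\<^sup>2"
    using R L m(1) pq unfolding p_def[symmetric] q_def[symmetric]
    by (intro add_mono mult_left_mono power_mono) auto
  also have "\<dots> \<le> exp (- 2 * (p * x + q * y))"
    using two_sided_bound[OF pq R(1,2) L(1,2)] by (simp add: power2_eq_square power3_eq_cube mult.assoc)
  finally have "ln (H\<^sup>2 * v) \<le> ln (exp (- 2 * (p * x + q * y)))" using m(1) v0 by (subst ln_le_cancel_iff) auto
  then have "2 * ln H + ln v \<le> - 2 * (p * x + q * y)" using m(1) v0 by (simp add: ln_mult ln_realpow)
  moreover have "h = 1 - ln H - (p * x + q * y)"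
  proof -
    have "h = (p + q) * (1 - ln H) - (p * x + q * y)"
      unfolding h R(6) L(6) p_def[symmetric] q_def[symmetric] by (simp add: algebra_simps)
    then show ?thesis using pq(3) by simp
  qed
  ultimately show "1 / 2 * ln v + 1 \<le> - (\<integral>x. f x * ln (f x) \<partial>lborel)" unfolding h_def[symmetric] by simp
qed

end

text \<open>A density $e^{-V}$ is replaced by its restriction to the interior of the domain of \<open>V\<close>. The domain is
convex, so only a null set is lost, and the restricted density is continuous where it is positive.\<close>

lemma log_concave_rv_density:
  assumes "prob_space M" "log_concave_rv M X"
  obtains f where "log_concave_density f" "distributed M lborel X (\<lambda>x. ennreal (f x))"
proof -
  interpret prob_space M by fact
  obtain V where V: "ereal_convex V" and D: "distributed M lborel X (\<lambda>x. ennreal (exp_minus (V x)))"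
    using assms(2) by (auto simp: log_concave_rv_def)
  define g where "g x = exp_minus (V x)" for x
  define U where "U = interior {x. V x \<noteq> \<infinity>}"
  define f where "f x = g x * indicator U x" for x
  have g0: "0 \<le> g x" for x by (simp add: g_def exp_minus_def)
  have [measurable]: "g \<in> borel_measurable borel"
  proof -
    have "(\<lambda>x. enn2real (ennreal (g x))) \<in> borel_measurable lborel"
      using distributed_borel_measurable[OF D] unfolding g_def by (rule measurable_compose) simp
    then show ?thesis using g0 by simp
  qed
  have conv: "V ((1 - t) * x + t * y) \<le> ereal (1 - t) * V x + ereal t * V y" if "0 \<le> t" "t \<le> 1" for x y t
    using V that unfolding ereal_convex_def by blast
  have fin: "V x = ereal (real_of_ereal (V x))" if "V x \<noteq> \<infinity>" for x
    using V that unfolding ereal_convex_def by (cases "V x") auto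
  have fin_conv: "V ((1 - t) * x + t * y) \<noteq> \<infinity> \<and>
      real_of_ereal (V ((1 - t) * x + t * y)) \<le> (1 - t) * real_of_ereal (V x) + t * real_of_ereal (V y)"
    if asm: "V x \<noteq> \<infinity>" "V y \<noteq> \<infinity>" "0 \<le> t" "t \<le> 1" for x y t
  proof -
    obtain a b where ab: "V x = ereal a" "V y = ereal b" using fin[OF asm(1)] fin[OF asm(2)] by blast
    have le: "V ((1 - t) * x + t * y) \<le> ereal ((1 - t) * a + t * b)" using conv[OF asm(3,4), of x y] ab by simp
    then have n: "V ((1 - t) * x + t * y) \<noteq> \<infinity>" by auto
    show ?thesis using le fin[OF n] n ab by (cases "V ((1 - t) * x + t * y)") auto
  qed
  have cU: "convex {x. V x \<noteq> \<infinity>}"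
    unfolding convex_alt using fin_conv by auto
  have pos: "{x. 0 < f x} = U"
    using interior_subset[of "{x. V x \<noteq> \<infinity>}"] by (auto simp: f_def g_def U_def exp_minus_def indicator_def)
  have ae: "AE x in lborel. ennreal (g x) = ennreal (f x)"
  proof -
    have "negligible (frontier {x. V x \<noteq> \<infinity>})" by (rule negligible_convex_frontier[OF cU])
    then have "frontier {x. V x \<noteq> \<infinity>} \<in> null_sets lebesgue" by (simp add: negligible_iff_null_sets)
    then have "frontier {x. V x \<noteq> \<infinity>} \<in> null_sets lborel"
      by (simp add: null_sets_completion_iff)
    then have "AE x in lborel. x \<notin> frontier {x. V x \<noteq> \<infinity>}" by (rule AE_not_in)
    then show ?thesis
    proof eventually_elim
      case (elim x)
      show ?case
      proof (cases "V x = \<infinity>")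
        case False
        then have "x \<in> U" using elim closure_subset[of "{x. V x \<noteq> \<infinity>}"] by (auto simp: frontier_def U_def)
        then show ?thesis by (simp add: f_def)
      qed (simp add: f_def g_def exp_minus_def)
    qed
  qed
  have oU: "open U" by (simp add: U_def)
  have [measurable]: "U \<in> sets borel" using oU by simp
  have [measurable]: "f \<in> borel_measurable borel" unfolding f_def[abs_def] by measurable
  have f0: "0 \<le> f x" for x using g0 by (simp add: f_def)
  have Df: "distributed M lborel X (\<lambda>x. ennreal (f x))"
    using D ae unfolding g_def[symmetric] by (subst (asm) distributed_cong_density) auto
  have nn: "(\<integral>\<^sup>+x. ennreal (f x) \<partial>lborel) = 1"
  proof -
    have "(\<integral>\<^sup>+x. ennreal (f x) \<partial>lborel) = emeasure (density lborel (\<lambda>x. ennreal (f x))) UNIV"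
      by (simp add: emeasure_density)
    also have "\<dots> = emeasure (distr M lborel X) UNIV" using distributed_distr_eq_density[OF Df] by simp
    also have "\<dots> = 1" using distributed_measurable[OF Df] emeasure_space_1 by (simp add: emeasure_distr)
    finally show ?thesis .
  qed
  have int: "integrable lborel f"
    by (rule integrableI_nonneg) (use nn f0 in auto)
  have "log_concave_density f"
  proof
    show "(\<integral>x. f x \<partial>lborel) = 1"
      using nn_integral_eq_integral[OF int] f0 nn by (simp add: ennreal_eq_1)
    show "concave_on {x. 0 < f x} (\<lambda>x. ln (f x))"
      unfolding pos concave_on_iff
    proof (intro conjI ballI allI impI)
      show cvU: "convex U" unfolding U_def by (rule convex_interior[OF cU])
      fix x y s t assume a: "x \<in> U" "y \<in> U" "0 \<le> s" "0 \<le> t" "s + t = (1::real)"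
      have s: "s = 1 - t" using a by simp
      have z: "(1 - t) * x + t * y \<in> U" using convexD[OF cvU a] s by simp
      have ln: "ln (f w) = - real_of_ereal (V w)" "V w \<noteq> \<infinity>" if "w \<in> U" for w
        using that interior_subset[of "{x. V x \<noteq> \<infinity>}"] by (auto simp: U_def f_def g_def exp_minus_def)
      show "s * ln (f x) + t * ln (f y) \<le> ln (f (s *\<^sub>R x + t *\<^sub>R y))"
        using fin_conv[of x y t] a ln z unfolding s by simp
    qed
  qed (use oU pos f0 int in auto)
  then show ?thesis using that Df by blast
qed

lemma exponential_log_concave:
  assumes "distributed M lborel X (\<lambda>x. ennreal (exp (- x) * indicator {0..} x))"
  shows "log_concave_rv M X"
proof -
  define V :: "real \<Rightarrow> ereal" where "V x = (if 0 \<le> x then ereal x else \<infinity>)" for x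
  have "ereal_convex V"
    unfolding ereal_convex_def
  proof (intro conjI allI impI)
    fix x y t :: real assume t: "0 \<le> t \<and> t \<le> 1"
    show "V ((1 - t) * x + t * y) \<le> ereal (1 - t) * V x + ereal t * V y"
    proof (cases "t = 0 \<or> t = 1 \<or> (0 \<le> x \<and> 0 \<le> y)")
      case True
      then show ?thesis using t by (auto simp: V_def zero_ereal_def[symmetric] one_ereal_def[symmetric])
    next
      case False
      then have "ereal (1 - t) * V x + ereal t * V y = \<infinity>" using t by (auto simp: V_def)
      then show ?thesis by (simp only: ereal_less_eq)
    qed
  qed (simp add: V_def)
  moreover have "exp_minus (V x) = exp (- x) * indicator {0..} x" for x
    by (simp add: V_def exp_minus_def)
  ultimately show ?thesis using assms unfolding log_concave_rv_def by (intro exI[of _ V]) simp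
qed

theorem theorem1p1:
  fixes M :: "'a measure" and X :: "'a \<Rightarrow> real"
  assumes "prob_space M"
  shows "(log_concave_rv M X \<longrightarrow>
            diff_entropy M X \<ge> 1/2 * ln (prob_space.variance M X) + 1) \<and>
         (distributed M lborel X (\<lambda>x. ennreal (exp (- x) * indicator {0..} x)) \<longrightarrow>
            log_concave_rv M X \<and>
            diff_entropy M X = 1/2 * ln (prob_space.variance M X) + 1)"
proof (intro conjI impI)
  interpret information_space M "exp 1"
    using assms by (simp add: information_space_def information_space_axioms_def)
  {
    assume "log_concave_rv M X"
    then obtain f where f: "log_concave_density f" and D: "distributed M lborel X (\<lambda>x. ennreal (f x))"
      using log_concave_rv_density[OF assms] by blast
    interpret log_concave_density f by fact
    have int: "integrable M (\<lambda>w. X w)" "integrable M (\<lambda>w. (X w)\<^sup>2)"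
      using distributed_integrable[OF D, of "\<lambda>x. x"] distributed_integrable[OF D, of "\<lambda>x. x\<^sup>2"]
        integrable_moments nonneg by (simp_all add: mult.commute)
    have E: "expectation X = (\<integral>x. x * f x \<partial>lborel)" "expectation (\<lambda>w. (X w)\<^sup>2) = (\<integral>x. x\<^sup>2 * f x \<partial>lborel)"
      using distributed_integral[OF D, of "\<lambda>x. x"] distributed_integral[OF D, of "\<lambda>x. x\<^sup>2"]
        nonneg by (simp_all add: mult.commute)
    have "variance X = (\<integral>x. x\<^sup>2 * f x \<partial>lborel) - (\<integral>x. x * f x \<partial>lborel)\<^sup>2"
      using variance_eq[OF int] by (simp add: E)
    then show "diff_entropy M X \<ge> 1/2 * ln (variance X) + 1"
      using variance_entropy diff_entropy_density[OF assms D nonneg] by simp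
  }
  assume D: "distributed M lborel X (\<lambda>x. ennreal (exp (- x) * indicator {0..} x))"
  show "log_concave_rv M X" by (rule exponential_log_concave[OF D])
  have "(\<lambda>x. ennreal (exp (- x) * indicator {0..} x)) = (\<lambda>x. ennreal (exponential_density 1 x))"
    by (auto simp: exponential_density_def)
  with D have De: "distributed M lborel X (exponential_density 1)" by simp
  have "diff_entropy M X = 1"
    unfolding diff_entropy_def using entropy_exponential[OF _ De] by (simp add: log_def)
  moreover have "variance X = 1" using exponential_distributed_variance[OF _ De] by simp
  ultimately show "diff_entropy M X = 1/2 * ln (variance X) + 1" by simp
qed

end
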